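(* Let $\mathbf r=\binom{r_1}{r_2}\in\mathbb Q^2$. For every $(A,\varepsilon)\in\mathrm{Mp}_2(\mathbb Z)$ with $A=\begin{pmatrix}a&b\\c&d\end{pmatrix}\in\Gamma_{\mathbf r}$ and every $\tau\in\mathbb H$, $$\theta_{\mathbf r}(A\cdot\tau)=\psi(A,\varepsilon)^3\chi_{\mathbf r}(A)\varepsilon(\tau)\theta_{\mathbf r}(\tau),$$ where $\chi_{\mathbf r}(A)=e\big(\tfrac12((c-d+1)r_1+(-a+b+1)r_2-cdr_1^2+2(a-1)dr_1r_2-(a-2)br_2^2)\big)$; moreover $\chi_{\mathbf r}$ is a character of $\Gamma_{\mathbf r}$.
   Context: $e(z)=e^{2\pi iz}$; $\mathbb H$ the upper half plane; $A\cdot\tau=\frac{a\tau+b}{c\tau+d}$; $\Gamma_{\mathbf r}=\{A\in\mathrm{SL}_2(\mathbb Z):A\mathbf r-\mathbf r\in\mathbb Z^2\}$. $\theta_{\mathbf r}(\tau)=\sum_{n\in\mathbb Z}e\big(\tfrac12(n+r_2+\tfrac12)^2\tau+(n+r_2+\tfrac12)(-r_1+\tfrac12)\big)$. $\mathrm{Mp}_2(\mathbb Z)$ is the set of pairs $(A,\varepsilon)$ with $A\in\mathrm{SL}_2(\mathbb Z)$ and $\varepsilon$ continuous on $\mathbb H$ with $\varepsilon(\tau)^2=c\tau+d$. With $\eta(\tau)=e(\tau/24)\prod_{k\ge1}(1-e(k\tau))$, $\psi(A,\varepsilon)$ is the constant with $\eta(A\cdot\tau)=\psi(A,\varepsilon)\varepsilon(\tau)\eta(\tau)$.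 *)

theory Defs
  imports "HOL-Analysis.Analysis"
begin

definition e :: "complex \<Rightarrow> complex" where
  "e z = exp (2 * pi * \<i> * z)"

definition uhp :: "complex set" where
  "uhp = {z. Im z > 0}"

text \<open>Integer 2x2 matrices (a,b,c,d) = [[a,b],[c,d]]\<close>
type_synonym mat2 = "int \<times> int \<times> int \<times> int"

definition SL2Z :: "mat2 set" where
  "SL2Z = {(a,b,c,d). a*d - b*c = 1}"

fun mmult :: "mat2 \<Rightarrow> mat2 \<Rightarrow> mat2" where
  "mmult (a,b,c,d) (a',b',c',d') = (a*a' + b*c', a*b' + b*d', c*a' + d*c', c*b' + d*d')"

fun moebius :: "mat2 \<Rightarrow> complex \<Rightarrow> complex" where
  "moebius (a,b,c,d) \<tau> = (of_int a * \<tau> + of_int b) / (of_int c * \<tau> + of_int d)"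

definition Gamma_r :: "real \<Rightarrow> real \<Rightarrow> mat2 set" where
  "Gamma_r r1 r2 = {(a,b,c,d). (a,b,c,d) \<in> SL2Z \<and>
      of_int a * r1 + of_int b * r2 - r1 \<in> \<int> \<and> of_int c * r1 + of_int d * r2 - r2 \<in> \<int>}"

definition theta_r :: "real \<Rightarrow> real \<Rightarrow> complex \<Rightarrow> complex" where
  "theta_r r1 r2 \<tau> = (\<Sum>\<^sub>\<infinity> n::int.
      e (complex_of_real ((of_int n + r2 + 1/2)^2 / 2) * \<tau>
         + complex_of_real ((of_int n + r2 + 1/2) * (- r1 + 1/2))))"

definition eta :: "complex \<Rightarrow> complex" where
  "eta \<tau> = e (\<tau> / 24) * (\<Prod>k. (1 - e (of_nat (Suc k) * \<tau>)))"

fun is_Mp2 :: "mat2 \<Rightarrow> (complex \<Rightarrow> complex) \<Rightarrow> bool" where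
  "is_Mp2 (a,b,c,d) \<epsilon> \<longleftrightarrow> (a,b,c,d) \<in> SL2Z \<and> continuous_on uhp \<epsilon> \<and>
      (\<forall>\<tau>\<in>uhp. (\<epsilon> \<tau>)^2 = of_int c * \<tau> + of_int d)"

definition psi :: "mat2 \<Rightarrow> (complex \<Rightarrow> complex) \<Rightarrow> complex" where
  "psi A \<epsilon> = (THE k. \<forall>\<tau>\<in>uhp. eta (moebius A \<tau>) = k * \<epsilon> \<tau> * eta \<tau>)"

fun chi_r :: "real \<Rightarrow> real \<Rightarrow> mat2 \<Rightarrow> complex" where
  "chi_r r1 r2 (a,b,c,d) = e (complex_of_real ((1/2) *
      ((of_int c - of_int d + 1) * r1 + (- of_int a + of_int b + 1) * r2
       - of_int c * of_int d * r1^2 + 2 * (of_int a - 1) * of_int d * r1 * r2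
       - (of_int a - 2) * of_int b * r2^2)))"

end

theory Submission
  imports Defs "HOL-Complex_Analysis.Complex_Analysis" "HOL-Probability.Characteristic_Functions"
begin

text \<open>
  Put \<open>\<Phi>\<^bsub>r\<^esub> = e((r\<^sub>1 r\<^sub>2 - r\<^sub>2)/2) \<theta>\<^bsub>r\<^esub>\<close>. For the generators \<open>T\<close> and \<open>S\<close> of the modular group
  one has \<open>\<Phi>\<^bsub>r\<^esub>(A \<tau>) = k\<^sup>3 \<epsilon>(\<tau>) \<Phi>\<^bsub>s\<^esub>(\<tau>)\<close> with \<open>s = A\<^sup>-\<^sup>1 r\<close>, where \<open>k\<close> is the constant in
  \<open>\<eta>(A \<tau>) = k \<epsilon>(\<tau>) \<eta>(\<tau>)\<close>. Both relations are stable under composition, so they hold for all of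
  \<open>SL\<^sub>2(Z)\<close> and every real \<open>r\<close>. For \<open>A\<close> in \<open>\<Gamma>\<^bsub>r\<^esub>\<close> the vector \<open>m = A\<^sup>-\<^sup>1 r - r\<close> is integral, and
  \<open>\<Phi>\<^bsub>r+m\<^esub> = e((r\<^sub>1 m\<^sub>2 - r\<^sub>2 m\<^sub>1 + m\<^sub>1 m\<^sub>2 - m\<^sub>1 - m\<^sub>2)/2) \<Phi>\<^bsub>r\<^esub>\<close>; this factor is \<open>\<chi>\<^bsub>r\<^esub>(A)\<close>.
  The character property is a parity computation with these shifts, using that
  \<open>m \<mapsto> m\<^sub>1 m\<^sub>2 + m\<^sub>1 + m\<^sub>2\<close> is, modulo 2, an \<open>SL\<^sub>2(Z)\<close>-invariant quadratic form.

  The inversion formula for theta is Poisson summation, obtained on the imaginary axis from the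
  Fourier transform of the Gaussian and the density of trigonometric polynomials, and extended by
  analytic continuation. The inversion formula for \<open>\<eta>\<close> follows from it, because the pentagonal
  number theorem (in the finite form of Shanks) exhibits \<open>\<eta>(\<tau>)\<close> as a theta series at \<open>3 \<tau>\<close>.
\<close>

section \<open>Theta series with characteristics\<close>

lemma e_add: "e (x + y) = e x * e y"
  by (simp add: e_def exp_add distrib_left)

lemma e_minus: "e (- x) = inverse (e x)"
  by (simp add: e_def exp_minus)

lemma e_0 [simp]: "e 0 = 1"
  by (simp add: e_def)

lemma e_nonzero [simp]: "e x \<noteq> 0"
  by (simp add: e_def)

lemma norm_e: "norm (e z) = exp (- 2 * pi * Im z)"
  by (simp add: e_def)

lemma e_of_int [simp]: "e (of_int n) = 1"
  using exp_integer_2pi[of "of_int n"] by (simp add: e_def mult_ac)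

lemma e_Ints: "x \<in> \<int> \<Longrightarrow> e x = 1"
  by (auto elim!: Ints_cases)

lemma e_cong_Ints: "x - y \<in> \<int> \<Longrightarrow> e x = e y"
  using e_add[of "x - y" y] e_Ints[of "x - y"] by simp

lemma e_of_nat_mult: "e (of_nat n * z) = e z ^ n"
  by (induction n) (auto simp: e_add distrib_right)

lemma continuous_on_e [continuous_intros]: "continuous_on S f \<Longrightarrow> continuous_on S (\<lambda>x. e (f x))"
  unfolding e_def by (intro continuous_intros)

lemma holomorphic_on_e [holomorphic_intros]: "f holomorphic_on S \<Longrightarrow> (\<lambda>x. e (f x)) holomorphic_on S"
  unfolding e_def by (intro holomorphic_intros)

lemma e_half: "e (1/2) = - 1"
  by (simp add: e_def exp_Euler)

text \<open>Summand of the classical theta series with real characteristics \<open>u\<close>,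
  \<open>v\<close>. Both stay general because inversion exchanges them up to sign and
  \<open>eta\<close> needs the values \<open>1/6\<close> and \<open>1/2\<close>.\<close>

definition theta_term :: "real \<Rightarrow> real \<Rightarrow> complex \<Rightarrow> int \<Rightarrow> complex" where
  "theta_term u v \<tau> n = e (complex_of_real ((of_int n + u)^2 / 2) * \<tau> + complex_of_real ((of_int n + u) * v))"

definition theta_char :: "real \<Rightarrow> real \<Rightarrow> complex \<Rightarrow> complex" where
  "theta_char u v \<tau> = (\<Sum>\<^sub>\<infinity> n. theta_term u v \<tau> n)"

lemma theta_r_eq: "theta_r r1 r2 = theta_char (r2 + 1/2) (1/2 - r1)"
  by (rule ext) (simp add: theta_r_def theta_char_def theta_term_def add.assoc)

lemma norm_theta_term: "norm (theta_term u v \<tau> n) = exp (- pi * (of_int n + u)^2 * Im \<tau>)"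
  by (simp add: theta_term_def norm_e)

text \<open>From \<open>|n| <= n^2 <= 2 (n + u)^2 + 2 u^2\<close> the Gaussian decay yields a
  geometric majorant in \<open>|n|\<close>, uniform for \<open>|u| <= R\<close> and
  \<open>Im \<tau> >= \<delta>\<close>. It serves all Weierstrass tests below.\<close>

lemma norm_theta_term_le:
  assumes "0 < \<delta>" "\<delta> \<le> Im \<tau>" "\<bar>u\<bar> \<le> R"
  shows "norm (theta_term u v \<tau> n) \<le> exp (pi * \<delta> * R^2) * exp (- pi * \<delta> / 2) ^ nat \<bar>n\<bar>"
proof -
  have "u^2 \<le> R^2"
    using assms(3) by (metis abs_ge_zero order_trans power2_abs power_mono)
  moreover have "(of_int n)^2 \<le> 2 * (of_int n + u)^2 + 2 * u^2"
    using zero_le_power2[of "of_int n + 2 * u"] by (simp add: power2_eq_square algebra_simps)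
  moreover have "real_of_int \<bar>n\<bar> \<le> (of_int n)^2"
    by (metis abs_of_nonneg int_one_le_iff_zero_less of_int_le_iff of_int_power power2_abs
        self_le_power abs_ge_zero le_less power_zero_numeral zero_less_numeral order_refl)
  ultimately have 1: "real_of_int \<bar>n\<bar> / 2 - R^2 \<le> (of_int n + u)^2"
    by linarith
  have "\<delta> * (real_of_int \<bar>n\<bar> / 2 - R^2) \<le> \<delta> * (of_int n + u)^2"
    using 1 assms by (intro mult_left_mono) auto
  also have "\<dots> \<le> Im \<tau> * (of_int n + u)^2"
    using assms by (intro mult_right_mono) auto
  finally have "pi * (\<delta> * (real_of_int \<bar>n\<bar> / 2 - R^2)) \<le> pi * (Im \<tau> * (of_int n + u)^2)"
    by (intro mult_left_mono) auto
  hence "norm (theta_term u v \<tau> n) \<le> exp (pi * \<delta> * R^2 + real (nat \<bar>n\<bar>) * (- pi * \<delta> / 2))"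
    unfolding norm_theta_term by (simp add: algebra_simps)
  thus ?thesis
    by (simp only: exp_add exp_of_nat_mult)
qed

lemma summable_on_power_abs:
  fixes x :: real
  assumes "0 \<le> x" "x < 1"
  shows "(\<lambda>n::int. x ^ nat \<bar>n\<bar>) summable_on UNIV"
proof -
  have geo: "(\<lambda>n. x ^ n) summable_on UNIV"
    using assms by (intro norm_summable_imp_summable_on) (simp add: summable_geometric)
  have geo': "(\<lambda>n. x ^ Suc n) summable_on UNIV"
    using geo by (simp add: summable_on_cmult_right)
  have 1: "(\<lambda>n::int. x ^ nat \<bar>n\<bar>) summable_on range int"
    using geo by (subst summable_on_reindex) (auto simp: o_def)
  have 2: "(\<lambda>n::int. x ^ nat \<bar>n\<bar>) summable_on range (\<lambda>n. - int (Suc n))"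
    using geo' by (subst summable_on_reindex) (auto simp: o_def inj_on_def nat_add_distrib add.commute)
  have "(\<lambda>n::int. x ^ nat \<bar>n\<bar>) summable_on range int \<union> range (\<lambda>n. - int (Suc n))"
    by (intro summable_on_Un_disjoint 1 2) auto
  also have "range int \<union> range (\<lambda>n. - int (Suc n)) = UNIV"
  proof -
    have "n \<in> range int \<union> range (\<lambda>n. - int (Suc n))" for n
      by (cases n) auto
    thus ?thesis by blast
  qed
  finally show ?thesis .
qed

lemma summable_theta_bound:
  assumes "0 < \<delta>"
  shows "(\<lambda>n::int. C * exp (- pi * \<delta> / 2) ^ nat \<bar>n\<bar>) summable_on UNIV"
  using assms by (intro summable_on_cmult_right summable_on_power_abs) auto

lemma theta_term_abs_summable:
  assumes "Im \<tau> > 0"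
  shows "(\<lambda>n. norm (theta_term u v \<tau> n)) summable_on UNIV"
  using norm_theta_term_le[OF assms order_refl order_refl]
  by (intro summable_on_comparison_test[OF summable_theta_bound[OF assms]]) auto

lemma theta_term_summable:
  assumes "Im \<tau> > 0"
  shows "theta_term u v \<tau> summable_on UNIV"
  using theta_term_abs_summable[OF assms] by (rule abs_summable_summable)

lemma theta_char_has_sum:
  assumes "Im \<tau> > 0"
  shows "(theta_term u v \<tau> has_sum theta_char u v \<tau>) UNIV"
  unfolding theta_char_def using theta_term_summable[OF assms] by simp

lemma open_uhp: "open uhp"
  unfolding uhp_def by (rule open_halfspace_Im_gt)

lemma convex_uhp: "convex uhp"
  unfolding uhp_def by (rule convex_halfspace_Im_gt)

lemma connected_uhp: "connected uhp"
  by (simp add: convex_uhp convex_connected)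

text \<open>On the closed disc around \<open>z\<close> of radius \<open>Im z / 2\<close> imaginary
  parts stay above \<open>Im z / 2\<close>, so the finite partial sums converge uniformly
  there.\<close>

lemma theta_char_holomorphic: "theta_char u v holomorphic_on uhp"
proof -
  have "\<exists>r>0. theta_char u v holomorphic_on ball z r" if z: "z \<in> uhp" for z
  proof -
    define \<delta> where "\<delta> = Im z / 2"
    have \<delta>: "\<delta> > 0" using z by (simp add: \<delta>_def uhp_def)
    have Im: "\<delta> \<le> Im w" if "w \<in> cball z \<delta>" for w
    proof -
      have "\<bar>Im (z - w)\<bar> \<le> \<delta>"
        using that abs_Im_le_cmod[of "z - w"] by (simp add: dist_norm)
      thus ?thesis unfolding \<delta>_def by (simp add: abs_if split: if_splits)
    qed
    have lim: "uniform_limit (cball z \<delta>) (\<lambda>X \<tau>. \<Sum>n\<in>X. theta_term u v \<tau> n)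
            (theta_char u v) (finite_subsets_at_top UNIV)"
      unfolding theta_char_def[abs_def]
      by (rule Weierstrass_m_test_general[OF norm_theta_term_le[OF \<delta> Im order_refl] summable_theta_bound[OF \<delta>]])
    have hol: "(\<lambda>\<tau>. \<Sum>n\<in>X. theta_term u v \<tau> n) holomorphic_on A" for X A
      unfolding theta_term_def by (intro holomorphic_intros)
    have "theta_char u v holomorphic_on ball z \<delta>"
    proof (rule holomorphic_uniform_limit[OF _ lim])
      show "\<forall>\<^sub>F X in finite_subsets_at_top UNIV.
          continuous_on (cball z \<delta>) (\<lambda>\<tau>. \<Sum>n\<in>X. theta_term u v \<tau> n) \<and>
          (\<lambda>\<tau>. \<Sum>n\<in>X. theta_term u v \<tau> n) holomorphic_on ball z \<delta>"
        using hol by (intro always_eventually allI conjI holomorphic_on_imp_continuous_on)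
    qed simp_all
    thus ?thesis using \<delta> by blast
  qed
  hence "theta_char u v analytic_on uhp" by (simp add: analytic_on_def)
  thus ?thesis by (rule analytic_imp_holomorphic)
qed

section \<open>The pentagonal number theorem\<close>

text \<open>As \<open>\<Sum>{..k}\<close> is the triangular number \<open>k (k + 1) / 2\<close>, the
  exponents on the right are the pentagonal numbers \<open>m (3 m + 1) / 2\<close> and
  \<open>m (3 m - 1) / 2\<close> with \<open>m = Suc k\<close>. The proof is by induction on
  \<open>n\<close>, with a telescoping certificate for the sum over \<open>s\<close>.\<close>

lemma shanks_identity:
  fixes q :: "'a :: field"
  assumes nz: "\<And>k. q ^ Suc k \<noteq> 1"
  defines "P \<equiv> \<lambda>n. \<Prod>k<n. 1 - q ^ Suc k"
  shows "(\<Sum>s\<le>n. (-1)^s * (P n / P s) * q ^ (s * n + \<Sum>{..s})) =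
         1 + (\<Sum>k<n. (-1)^Suc k * (q ^ (Suc k * Suc k + \<Sum>{..Suc k}) + q ^ (Suc k * Suc k + \<Sum>{..k})))"
proof (induction n)
  case 0
  show ?case by (simp add: P_def)
next
  case (Suc n)
  have P: "P k \<noteq> 0" for k
    using nz by (simp add: P_def)
  have P_Suc: "P (Suc k) = P k * (1 - q ^ Suc k)" for k
    by (simp add: P_def)
  define T where "T = (\<lambda>n s. (-1)^s * (P n / P s) * q ^ (s * n + \<Sum>{..s}))"
  \<comment> \<open>The certificate: raising \<open>n\<close> by one changes the summand
    \<open>T n s\<close> by \<open>H s - H (Suc s)\<close>. With \<open>H 0 = 0\<close> the sum
    collapses to \<open>- H (Suc n)\<close>.\<close>
  define H where "H = (\<lambda>s. case s of 0 \<Rightarrow> 0 | Suc j \<Rightarrow> (-1)^j * (P n / P j) * q ^ (Suc j * Suc n + \<Sum>{..j}))"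
  have "T (Suc n) s - T n s = H s - H (Suc s)" for s
  proof (cases s)
    case 0
    show ?thesis using P[of 0] P[of n]
      by (simp add: T_def H_def 0 P_Suc ring_distribs diff_divide_distrib)
  next
    case (Suc j)
    define X where "X = q ^ (s * n + \<Sum>{..j})"
    have 1: "q ^ (s * Suc n + \<Sum>{..s}) = X * q ^ s * q ^ s" "q ^ (s * n + \<Sum>{..s}) = X * q ^ s"
      "q ^ (s * Suc n + \<Sum>{..j}) = X * q ^ s"
      "q ^ (Suc s * Suc n + \<Sum>{..s}) = X * q ^ s * q ^ s * q ^ Suc n"
      unfolding X_def power_add[symmetric] by (rule arg_cong[where f = "(^) q"]; simp add: Suc)+
    have Ps: "P s = P j * (1 - q ^ s)"
      using P_Suc[of j] Suc by simp
    have q: "1 - q ^ s \<noteq> 0"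
      using nz[of j] Suc by simp
    have Hs: "H s = - ((-1) ^ s * (P n / P j) * (X * q ^ s))"
      using 1(3) by (simp add: H_def Suc)
    have HSs: "H (Suc s) = (-1) ^ s * (P n / P s) * (X * q ^ s * q ^ s * q ^ Suc n)"
      using 1(4) by (simp add: H_def)
    show ?thesis
      unfolding Hs HSs T_def 1 P_Suc[of n] Ps using P[of j] q by (simp add: divide_simps) algebra
  qed
  hence "(\<Sum>s\<le>n. T (Suc n) s) - (\<Sum>s\<le>n. T n s) = H 0 - H (Suc n)"
    unfolding sum_subtractf[symmetric] using sum_telescope[of H n] by simp
  also have "\<dots> = (-1) ^ Suc n * q ^ (Suc n * Suc n + \<Sum>{..n})"
    using P[of n] by (simp add: H_def)
  finally have "(\<Sum>s\<le>Suc n. T (Suc n) s) = (\<Sum>s\<le>n. T n s)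
      + (-1) ^ Suc n * q ^ (Suc n * Suc n + \<Sum>{..n}) + T (Suc n) (Suc n)"
    by (simp add: algebra_simps)
  also have "T (Suc n) (Suc n) = (-1) ^ Suc n * q ^ (Suc n * Suc n + \<Sum>{..Suc n})"
    unfolding T_def using P[of "Suc n"] by (metis divide_self mult.right_neutral)
  also have "(\<Sum>s\<le>n. T n s) = 1 + (\<Sum>k<n. (-1)^Suc k * (q ^ (Suc k * Suc k + \<Sum>{..Suc k}) + q ^ (Suc k * Suc k + \<Sum>{..k})))"
    using Suc by (simp only: T_def)
  finally show ?case
    unfolding T_def sum.lessThan_Suc distrib_left add.assoc by (simp only: ac_simps)
qed

text \<open>In Shanks' identity the summand \<open>s = 0\<close> is the partial product itself. The
  other \<open>n\<close> summands are each \<open>O(|q|^n)\<close>, because the partial products and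
  their inverses are bounded, so they vanish in the limit.\<close>

lemma pentagonal_tendsto:
  fixes q :: complex
  assumes q: "norm q < 1"
  shows "(\<lambda>n. 1 + (\<Sum>k<n. (-1)^Suc k * (q ^ (Suc k * Suc k + \<Sum>{..Suc k}) + q ^ (Suc k * Suc k + \<Sum>{..k}))))
           \<longlonglongrightarrow> (\<Prod>k. 1 - q ^ Suc k)"
    and "(\<Prod>k. 1 - q ^ Suc k) \<noteq> 0"
proof -
  define P where "P = (\<lambda>n. \<Prod>k<n. 1 - q ^ Suc k)"
  have pow: "norm (q ^ Suc k) < 1" for k
    using q power_less_one_iff[of "norm q" "Suc k"] by (simp add: norm_power del: power_Suc)
  have nz: "q ^ Suc k \<noteq> 1" for k
    using pow[of k] by (metis norm_one less_irrefl)
  have "summable (\<lambda>k. norm (1 - q ^ Suc k - 1))"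
    using q by (simp add: norm_mult norm_power summable_mult summable_geometric)
  hence "abs_convergent_prod (\<lambda>k. 1 - q ^ Suc k)"
    by (rule summable_imp_abs_convergent_prod)
  hence conv: "convergent_prod (\<lambda>k. 1 - q ^ Suc k)"
    by (rule abs_convergent_prod_imp_convergent_prod)
  show nz': "(\<Prod>k. 1 - q ^ Suc k) \<noteq> 0"
    using conv nz by (intro prodinf_nonzero) auto
  have P_lim: "P \<longlonglongrightarrow> (\<Prod>k. 1 - q ^ Suc k)"
    using convergent_prod_LIMSEQ[OF conv] unfolding P_def by (simp only: LIMSEQ_lessThan_iff_atMost)
  have P0: "P 0 = 1" by (simp add: P_def)
  obtain B where B: "\<And>n. norm (P n) \<le> B"
    using P_lim convergent_imp_Bseq convergentI BseqE by metis
  have "(\<lambda>n. inverse (P n)) \<longlonglongrightarrow> inverse (\<Prod>k. 1 - q ^ Suc k)"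
    using P_lim nz' by (intro tendsto_inverse)
  then obtain B' where B': "\<And>n. norm (inverse (P n)) \<le> B'"
    using convergent_imp_Bseq convergentI BseqE by metis
  have Bnn: "0 \<le> B" "0 \<le> B'" using B[of 0] B'[of 0] norm_ge_zero order_trans by blast+
  define R where "R = (\<lambda>n. \<Sum>s\<in>{1..n}. (-1)^s * (P n / P s) * q ^ (s * n + \<Sum>{..s}))"
  have "norm (R n) \<le> B * B' * (of_nat n * norm q ^ n)" for n
  proof -
    have "norm (R n) \<le> (\<Sum>s\<in>{1..n}. B * B' * norm q ^ n)"
      unfolding R_def
    proof (intro sum_norm_le)
      fix s assume s: "s \<in> {1..n}"
      have "n \<le> s * n + \<Sum>{..s}" using s by (simp add: trans_le_add1)
      hence "norm q ^ (s * n + \<Sum>{..s}) \<le> norm q ^ n"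
        using q by (intro power_decreasing) auto
      hence "norm (P n) * norm (inverse (P s)) * norm q ^ (s * n + \<Sum>{..s}) \<le> B * B' * norm q ^ n"
        using B B' Bnn by (intro mult_mono) auto
      thus "norm ((-1)^s * (P n / P s) * q ^ (s * n + \<Sum>{..s})) \<le> B * B' * norm q ^ n"
        by (simp add: norm_mult norm_power norm_divide norm_inverse divide_inverse)
    qed
    thus ?thesis by (simp add: mult_ac)
  qed
  moreover have "(\<lambda>n. B * B' * (of_nat n * norm q ^ n)) \<longlonglongrightarrow> B * B' * 0"
    using q by (intro tendsto_mult tendsto_const powser_times_n_limit_0) auto
  ultimately have "R \<longlonglongrightarrow> 0"
    by (intro Lim_null_comparison[of R]) auto
  hence "(\<lambda>n. P n + R n) \<longlonglongrightarrow> (\<Prod>k. 1 - q ^ Suc k) + 0"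
    using P_lim by (intro tendsto_add)
  also have "(\<lambda>n. P n + R n) = (\<lambda>n. \<Sum>s\<le>n. (-1)^s * (P n / P s) * q ^ (s * n + \<Sum>{..s}))"
  proof
    fix n :: nat
    have "{..n} = insert 0 {1..n}" by auto
    thus "P n + R n = (\<Sum>s\<le>n. (-1)^s * (P n / P s) * q ^ (s * n + \<Sum>{..s}))"
      by (simp add: R_def P0)
  qed
  finally show "(\<lambda>n. 1 + (\<Sum>k<n. (-1)^Suc k * (q ^ (Suc k * Suc k + \<Sum>{..Suc k}) + q ^ (Suc k * Suc k + \<Sum>{..k}))))
           \<longlonglongrightarrow> (\<Prod>k. 1 - q ^ Suc k)"
    unfolding P_def shanks_identity[OF nz] by simp
qed

section \<open>Uniqueness of Fourier coefficients\<close>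

text \<open>Lets an unordered sum over the integers be computed as a limit of symmetric partial
  sums, as needed for unfolding integrals and for the pentagonal series.\<close>

lemma filterlim_symmetric_int_intervals:
  "filterlim (\<lambda>n. {-int n..int n}) (finite_subsets_at_top UNIV) sequentially"
  unfolding filterlim_finite_subsets_at_top
proof safe
  fix X :: "int set" assume X: "finite X"
  define N where "N = nat (Max (insert 0 (abs ` X)))"
  have N: "\<bar>x\<bar> \<le> int N" if "x \<in> X" for x
    using X that by (auto simp: N_def intro!: le_nat_iff[THEN iffD1] Max_ge order.trans[OF Max_ge[of "insert 0 (abs ` X)"]])
  show "\<forall>\<^sub>F n in sequentially. finite {-int n..int n} \<and> X \<subseteq> {-int n..int n} \<and> {-int n..int n} \<subseteq> UNIV"
    using eventually_ge_at_top[of N]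
  proof eventually_elim
    case (elim n)
    have "X \<subseteq> {-int n..int n}" using N elim by force
    thus ?case by simp
  qed
qed

lemma has_sum_int_imp_tendsto:
  assumes "(f has_sum S) (UNIV :: int set)"
  shows "(\<lambda>n. \<Sum>k\<in>{-int n..int n}. f k) \<longlonglongrightarrow> S"
  using filterlim_compose[OF assms[unfolded has_sum_def] filterlim_symmetric_int_intervals] .

text \<open>Closure rules in place of explicit coefficient families, so that products, continuity
  and vanishing integrals follow by rule induction.\<close>

inductive trig_poly :: "(real \<Rightarrow> complex) \<Rightarrow> bool" where
  monomial: "trig_poly (\<lambda>x. c * e (complex_of_real (of_int k * x)))"
| add: "trig_poly f \<Longrightarrow> trig_poly g \<Longrightarrow> trig_poly (\<lambda>x. f x + g x)"

lemma trig_poly_const: "trig_poly (\<lambda>x. c)"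
  using trig_poly.monomial[of c 0] by simp

lemma trig_poly_mult_monomial:
  "trig_poly f \<Longrightarrow> trig_poly (\<lambda>x. c * e (complex_of_real (of_int k * x)) * f x)"
proof (induction rule: trig_poly.induct)
  case (monomial c' k')
  have "(\<lambda>x. c * e (complex_of_real (of_int k * x)) * (c' * e (complex_of_real (of_int k' * x)))) =
        (\<lambda>x. (c * c') * e (complex_of_real (of_int (k + k') * x)))"
    by (simp add: fun_eq_iff e_add algebra_simps)
  thus ?case by (simp only: trig_poly.monomial)
next
  case (add f g)
  thus ?case by (simp add: distrib_left trig_poly.add)
qed

lemma trig_poly_mult: "trig_poly f \<Longrightarrow> trig_poly g \<Longrightarrow> trig_poly (\<lambda>x. f x * g x)"
proof (induction rule: trig_poly.induct)
  case (monomial c k)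
  thus ?case by (rule trig_poly_mult_monomial)
next
  case (add f1 f2)
  thus ?case by (simp add: distrib_right trig_poly.add)
qed

text \<open>On the unit circle \<open>cnj z = inverse z\<close>, so a real-linear form is a
  combination of \<open>e x\<close> and \<open>e (- x)\<close>; sums and products then stay
  trigonometric.\<close>

lemma trig_poly_real_polynomial_function:
  assumes "real_polynomial_function p"
  shows "trig_poly (\<lambda>x. complex_of_real (p (e (complex_of_real x))))"
  using assms
proof (induction rule: real_polynomial_function.induct)
  case (linear f)
  interpret bounded_linear f by fact
  \<comment> \<open>The coefficients in \<open>f z = A * z + B * cnj z\<close>, determined by the
    values of \<open>f\<close> at \<open>1\<close> and \<open>\<i>\<close>.\<close>
  define A B where "A = (of_real (f 1) - \<i> * of_real (f \<i>)) / 2" and "B = (of_real (f 1) + \<i> * of_real (f \<i>)) / 2"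
  have "complex_of_real (f (e (complex_of_real x))) =
      A * e (complex_of_real (of_int 1 * x)) + B * e (complex_of_real (of_int (-1) * x))" for x
  proof -
    define z where "z = e (complex_of_real x)"
    have "norm z = 1" by (simp add: z_def norm_e)
    hence inv: "inverse z = cnj z"
      by (intro inverse_unique) (simp flip: complex_norm_square)
    have "z = Re z *\<^sub>R 1 + Im z *\<^sub>R \<i>"
      by (simp add: complex_eq_iff)
    hence "f z = f (Re z *\<^sub>R 1 + Im z *\<^sub>R \<i>)"
      by (rule arg_cong)
    also have "\<dots> = Re z * f 1 + Im z * f \<i>"
      by (simp only: add scaleR real_scaleR_def)
    finally have "f z = Re z * f 1 + Im z * f \<i>" .
    moreover have "complex_of_real (Re z * f 1 + Im z * f \<i>) = A * z + B * cnj z"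
      by (simp add: A_def B_def complex_eq_iff field_simps)
    ultimately show ?thesis
      by (simp add: z_def e_minus inv[unfolded z_def])
  qed
  thus ?case by (simp only: trig_poly.intros)
qed (auto simp: trig_poly_const intro: trig_poly.add trig_poly_mult)

lemma periodic_of_int:
  fixes h :: "real \<Rightarrow> 'a"
  assumes "\<And>x. h (x + 1) = h x"
  shows "h (x + of_int n) = h x"
proof (induction n rule: int_induct[where k = 0])
  case (step1 i)
  thus ?case using assms[of "x + of_int i"] by (simp add: add_ac)
next
  case (step2 i)
  thus ?case using assms[of "x + of_int (i - 1)"] by simp
qed simp

lemma e_of_real_eq_iff:
  "e (complex_of_real x) = e (complex_of_real y) \<longleftrightarrow> (\<exists>n::int. x = y + of_int n)"
proof -
  have "e (complex_of_real x) = e (complex_of_real y) \<longleftrightarrow>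
     (\<exists>n::int. 2 * of_real pi * \<i> * of_real x = 2 * of_real pi * \<i> * of_real y + (of_int (2 * n) * of_real pi) * \<i>)"
    unfolding e_def exp_eq by simp
  also have "\<dots> \<longleftrightarrow> (\<exists>n::int. (2 * of_real pi * \<i>) * complex_of_real x = (2 * of_real pi * \<i>) * complex_of_real (y + of_int n))"
    by (simp add: ring_distribs mult_ac)
  also have "\<dots> \<longleftrightarrow> (\<exists>n::int. x = y + of_int n)"
    unfolding mult_cancel_left of_real_eq_iff by simp
  finally show ?thesis .
qed

lemma e_of_real_Ln:
  assumes "norm z = 1"
  shows "e (complex_of_real (Im (Ln z) / (2 * pi))) = z"
proof -
  have z: "z \<noteq> 0" using assms by auto
  have "Re (Ln z) = 0" using assms z by (simp add: Re_Ln)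
  hence "Ln z = \<i> * of_real (Im (Ln z))" by (simp add: complex_eq_iff)
  hence "z = exp (\<i> * of_real (Im (Ln z)))" using exp_Ln[OF z] by metis
  thus ?thesis by (simp add: e_def)
qed

text \<open>The argument has no continuous choice on the circle: near \<open>-1\<close> continuity is read off from
  the branch \<open>Ln (- z)\<close>, which periodicity makes equivalent.\<close>
lemma periodic_factor_circle:
  fixes h :: "real \<Rightarrow> complex"
  assumes cont: "continuous_on UNIV h" and per: "\<And>x. h (x + 1) = h x"
  obtains H where "continuous_on (sphere 0 1) H" "\<And>x. H (e (complex_of_real x)) = h x"
proof -
  define H where "H = (\<lambda>z. h (Im (Ln z) / (2 * pi)))"
  have heq: "h x = h y" if "e (complex_of_real x) = e (complex_of_real y)" for x y
    using that periodic_of_int[where h = h, OF per] by (auto simp: e_of_real_eq_iff)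
  have "H (e (complex_of_real x)) = h x" for x
    unfolding H_def by (intro heq e_of_real_Ln) (simp add: norm_e)
  moreover have ch: "isCont h x" for x
    using cont by (simp add: continuous_on_eq_continuous_at)
  moreover have "continuous_on (sphere 0 1) H"
    unfolding continuous_on_eq_continuous_within
  proof
    fix z :: complex assume z: "z \<in> sphere 0 1"
    show "continuous (at z within sphere 0 1) H"
    proof (cases "z \<in> \<real>\<^sub>\<le>\<^sub>0")
      case False
      hence "isCont (\<lambda>z. Im (Ln z) / (2 * pi)) z"
        by (intro continuous_intros) auto
      hence "isCont H z"
        unfolding H_def by (rule isCont_o2[OF _ ch])
      thus ?thesis by (rule continuous_at_imp_continuous_within)
    next
      case True
      hence "- z \<notin> \<real>\<^sub>\<le>\<^sub>0" using z by (auto simp: complex_nonpos_Reals_iff cmod_def)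
      hence "isCont (\<lambda>z. Im (Ln (- z)) / (2 * pi) + 1/2) z"
        by (intro continuous_intros) auto
      hence "isCont (\<lambda>z. h (Im (Ln (- z)) / (2 * pi) + 1/2)) z"
        by (rule isCont_o2[OF _ ch])
      hence "continuous (at z within sphere 0 1) (\<lambda>z. h (Im (Ln (- z)) / (2 * pi) + 1/2))"
        by (rule continuous_at_imp_continuous_within)
      moreover have "h (Im (Ln (- w)) / (2 * pi) + 1/2) = H w" if "w \<in> sphere 0 1" for w
        unfolding H_def
      proof (rule heq)
        have "e (complex_of_real (Im (Ln (- w)) / (2 * pi) + 1/2)) = e (complex_of_real (Im (Ln (- w)) / (2 * pi))) * e (1/2)"
          by (simp add: e_add)
        also have "\<dots> = w"
          using that by (subst e_of_real_Ln) (auto simp: e_half)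
        also have "\<dots> = e (complex_of_real (Im (Ln w) / (2 * pi)))"
          using that by (subst e_of_real_Ln) auto
        finally show "e (complex_of_real (Im (Ln (- w)) / (2 * pi) + 1/2)) = e (complex_of_real (Im (Ln w) / (2 * pi)))" .
      qed
      ultimately show ?thesis
        using z by (elim continuous_transform_within[where \<delta> = 1]) auto
    qed
  qed
  ultimately show ?thesis using that by blast
qed

lemma trig_poly_continuous: "trig_poly p \<Longrightarrow> continuous_on S p"
  by (induction rule: trig_poly.induct) (auto intro!: continuous_intros)

text \<open>Stone-Weierstrass on the circle, pulled back along \<open>x \<mapsto> e x\<close>. Real
  and imaginary parts of the approximating polynomial map are treated separately.\<close>

lemma periodic_approx_trig_poly:
  fixes h :: "real \<Rightarrow> complex"
  assumes cont: "continuous_on UNIV h" and per: "\<And>x. h (x + 1) = h x" and "\<epsilon> > 0"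
  obtains p where "trig_poly p" "\<And>x. norm (h x - p x) < \<epsilon>"
proof -
  obtain H where H: "continuous_on (sphere 0 1) H" "\<And>x. H (e (complex_of_real x)) = h x"
    using periodic_factor_circle[OF cont per] by blast
  obtain g where g: "polynomial_function g" "\<And>z. z \<in> sphere 0 1 \<Longrightarrow> norm (H z - g z) < \<epsilon>"
    using Stone_Weierstrass_polynomial_function[OF _ H(1) \<open>\<epsilon> > 0\<close>] compact_sphere by blast
  have ReIm: "real_polynomial_function (\<lambda>z. Re (g z))" "real_polynomial_function (\<lambda>z. Im (g z))"
    using g(1) bounded_linear_Re bounded_linear_Im by (auto simp: polynomial_function_def o_def)
  show ?thesis
  proof
    show "trig_poly (\<lambda>x. of_real (Re (g (e (of_real x)))) + \<i> * of_real (Im (g (e (of_real x)))))"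
      by (intro trig_poly.add trig_poly_mult trig_poly_const trig_poly_real_polynomial_function ReIm)
    show "norm (h x - (of_real (Re (g (e (of_real x)))) + \<i> * of_real (Im (g (e (of_real x)))))) < \<epsilon>" for x
      using g(2)[of "e (of_real x)"] H(2)[of x] by (simp only: complex_eq[symmetric]) (simp add: norm_e)
  qed
qed

text \<open>By linearity \<open>h\<close> is orthogonal to every trigonometric polynomial.
  Approximating \<open>cnj h\<close> by such polynomials forces the integral of \<open>|h|^2\<close>
  to vanish.\<close>

lemma fourier_uniqueness:
  fixes h :: "real \<Rightarrow> complex"
  assumes cont: "continuous_on UNIV h" and per: "\<And>x. h (x + 1) = h x"
    and coeff: "\<And>k::int. integral {0..1} (\<lambda>x. h x * e (complex_of_real (of_int k * x))) = 0"
  shows "h x = 0"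
proof -
  have cont': "continuous_on {0..1} h" using cont continuous_on_subset by blast
  have trig: "integral {0..1} (\<lambda>x. h x * p x) = 0" if "trig_poly p" for p
    using that
  proof (induction rule: trig_poly.induct)
    case (monomial c k)
    have "integral {0..1} (\<lambda>x. c * (h x * e (complex_of_real (of_int k * x)))) = 0"
      using coeff by simp
    thus ?case by (simp only: mult_ac)
  next
    case (add f g)
    have "integral {0..1} (\<lambda>x. h x * f x + h x * g x) = 0"
      using add.IH add.hyps[THEN trig_poly_continuous] cont'
      by (subst integral_add) (simp_all add: integrable_continuous_interval continuous_on_mult)
    thus ?case by (simp only: distrib_left)
  qed
  have "compact (h ` {0..1})" using cont' compact_continuous_image by blast
  hence "bounded (h ` {0..1})" by (rule compact_imp_bounded)
  then obtain M where M: "\<And>x. x \<in> {0..1} \<Longrightarrow> norm (h x) \<le> M"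
    unfolding bounded_iff by blast
  have M0: "0 \<le> M" using order_trans[OF norm_ge_zero M[of 0]] by simp
  define I where "I = integral {0..1} (\<lambda>x. (norm (h x))^2)"
  have I_le: "norm I \<le> M * \<epsilon>" if "\<epsilon> > 0" for \<epsilon>
  proof -
    obtain p where p: "trig_poly p" "\<And>x. norm (cnj (h x) - p x) < \<epsilon>"
    proof (rule periodic_approx_trig_poly[OF continuous_on_cnj[OF cont] _ \<open>\<epsilon> > 0\<close>])
      show "cnj (h (x + 1)) = cnj (h x)" for x by (simp only: per)
    qed blast
    note cts = cont' continuous_on_cnj[OF cont'] trig_poly_continuous[OF p(1)]
    have "of_real I = integral {0..1} (\<lambda>x. complex_of_real ((norm (h x))^2))"
      unfolding I_def using integral_linear[of "\<lambda>x. (norm (h x))^2" "{0..1}" complex_of_real] cont'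
      by (simp add: o_def integrable_continuous_interval continuous_on_power continuous_on_norm bounded_linear_of_real)
    also have "\<dots> = integral {0..1} (\<lambda>x. h x * cnj (h x)) - integral {0..1} (\<lambda>x. h x * p x)"
      using trig[OF p(1)] by (simp add: complex_norm_square del: of_real_power)
    also have "\<dots> = integral {0..1} (\<lambda>x. h x * (cnj (h x) - p x))"
      by (subst integral_diff[symmetric])
         (simp_all add: integrable_continuous_interval continuous_on_mult cts right_diff_distrib)
    finally have I_eq: "of_real I = integral {0..1} (\<lambda>x. h x * (cnj (h x) - p x))" .
    have "norm (integral {0..1} (\<lambda>x. h x * (cnj (h x) - p x))) \<le> M * \<epsilon> * (1 - 0)"
    proof (rule integral_bound)
      show "continuous_on {0..1} (\<lambda>x. h x * (cnj (h x) - p x))"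
        by (intro continuous_on_mult continuous_on_diff cts)
      show "norm (h x * (cnj (h x) - p x)) \<le> M * \<epsilon>" if "x \<in> {0..1}" for x
        unfolding norm_mult using M[OF that] p(2)[of x] M0 by (intro mult_mono) auto
    qed simp
    thus ?thesis by (simp flip: I_eq)
  qed
  have "I = 0"
  proof (rule ccontr)
    assume "I \<noteq> 0"
    \<comment> \<open>This choice of \<open>\<epsilon>\<close> gives
      \<open>norm I <= M / (M + 1) * norm I\<close>; the \<open>+ 1\<close> avoids division by zero
      if \<open>M = 0\<close>.\<close>
    hence "norm I / (M + 1) > 0" using M0 by simp
    from I_le[OF this] have "norm I * (M + 1) \<le> M * norm I" using M0 by (simp add: field_simps)
    thus False using \<open>I \<noteq> 0\<close> by (simp add: algebra_simps)
  qed
  hence z: "norm (h x) ^ 2 = 0" if "x \<in> {0..1}" for x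
    using that integral_eq_0_iff[of 0 1 "\<lambda>x. (norm (h x))^2"]
    by (simp add: I_def continuous_on_power continuous_on_norm cont')
  have "h x = h (frac x)"
    using periodic_of_int[where h = h, OF per, of "frac x" "\<lfloor>x\<rfloor>"] by (simp add: frac_def)
  thus ?thesis using z[of "frac x"] by (simp add: frac_lt_1 less_imp_le)
qed

section \<open>Inversion of theta series\<close>

text \<open>The Gaussian \<open>exp (- pi s x^2)\<close> times the wave \<open>e (x \<xi>)\<close>:
  a theta summand at \<open>\<i> s\<close> with \<open>n + u\<close> replaced by a real
  variable.\<close>

definition gauss_wave :: "real \<Rightarrow> real \<Rightarrow> real \<Rightarrow> complex" where
  "gauss_wave s \<xi> x = e (complex_of_real (x^2 / 2) * (\<i> * of_real s) + complex_of_real (x * \<xi>))"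

lemma continuous_on_gauss_wave: "continuous_on A (gauss_wave s \<xi>)"
  unfolding gauss_wave_def by (intro continuous_intros) auto

text \<open>Rescaling turns the integrand into the standard normal density times a wave, whose
  integral is the known characteristic function.\<close>

lemma gauss_wave_fourier:
  assumes s: "s > 0"
  shows "integrable lborel (gauss_wave s \<xi>)"
    and "integral\<^sup>L lborel (gauss_wave s \<xi>) = of_real (exp (- pi * \<xi>^2 / s) / sqrt s)"
proof -
  \<comment> \<open>The scale for which \<open>(c x)^2 / 2 = pi s x^2\<close>; the frequency
    \<open>t\<close> is then fixed by \<open>t c x = 2 pi \<xi> x\<close>.\<close>
  define c where "c = sqrt (2 * pi * s)"
  have c: "c > 0" "c^2 = 2 * pi * s" using s by (auto simp: c_def)
  define t where "t = 2 * pi * \<xi> / c"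
  define k where "k = (\<lambda>y. std_normal_density y *\<^sub>R iexp (t * y))"
  have gk: "gauss_wave s \<xi> x = sqrt (2 * pi) *\<^sub>R k (0 + c * x)" for x
  proof -
    have "k (0 + c * x) = of_real (1 / sqrt (2 * pi)) * (of_real (exp (- pi * s * x^2)) * exp (2 * pi * \<i> * (x * \<xi>)))"
      using c by (simp add: k_def normal_density_def t_def power_mult_distrib scaleR_conv_of_real mult_ac)
    also have "of_real (exp (- pi * s * x^2)) * exp (2 * pi * \<i> * (x * \<xi>)) = gauss_wave s \<xi> x"
      by (simp add: gauss_wave_def e_def exp_of_real[symmetric] exp_add[symmetric] algebra_simps)
    finally show ?thesis by (simp add: scaleR_conv_of_real)
  qed
  have k_meas: "k \<in> borel_measurable lborel"
    unfolding k_def normal_density_def measurable_lborel2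
    by (intro borel_measurable_continuous_onI continuous_intros) auto
  have k_int: "integrable lborel k"
    by (rule Bochner_Integration.integrable_bound[OF integrable_normal_density[of 1 0] k_meas])
       (auto simp: k_def)
  have "integral\<^sup>L lborel k = char std_normal_distribution t"
    unfolding char_def k_def by (subst integral_density) auto
  also have "\<dots> = of_real (exp (- (t^2) / 2))"
    by (simp add: char_std_normal_distribution)
  also have "- (t^2) / 2 = - pi * \<xi>^2 / s"
    unfolding t_def power_divide c(2) using s by (simp add: field_simps power2_eq_square)
  finally have k_val: "integral\<^sup>L lborel k = of_real (exp (- pi * \<xi>^2 / s))" .
  have "integrable lborel (\<lambda>x. k (0 + c * x))"
    using c by (intro lborel_integrable_real_affine k_int) auto
  thus "integrable lborel (gauss_wave s \<xi>)"
    unfolding gk[abs_def] by (intro integrable_scaleR_right)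
  have "integral\<^sup>L lborel k = c *\<^sub>R integral\<^sup>L lborel (\<lambda>x. k (0 + c * x))"
    using lborel_integral_real_affine[of c k 0] c by simp
  hence "integral\<^sup>L lborel (gauss_wave s \<xi>) = (sqrt (2 * pi) / c) *\<^sub>R integral\<^sup>L lborel k"
    unfolding gk[abs_def] using c by simp
  also have "sqrt (2 * pi) / c = 1 / sqrt s"
    using s by (simp add: c_def real_sqrt_mult)
  finally show "integral\<^sup>L lborel (gauss_wave s \<xi>) = of_real (exp (- pi * \<xi>^2 / s) / sqrt s)"
    by (simp add: k_val scaleR_conv_of_real)
qed

text \<open>Termwise integration, justified by the uniform convergence from the Weierstrass
  test.\<close>

lemma has_sum_integral:
  fixes f :: "'a \<Rightarrow> real \<Rightarrow> complex"
  assumes cont: "\<And>n. continuous_on {a..b} (f n)"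
    and bound: "\<And>n x. x \<in> {a..b} \<Longrightarrow> norm (f n x) \<le> M n" and M: "M summable_on UNIV"
  shows "((\<lambda>n. integral {a..b} (f n)) has_sum integral {a..b} (\<lambda>x. \<Sum>\<^sub>\<infinity>n. f n x)) UNIV"
proof -
  have lim: "uniform_limit {a..b} (\<lambda>X x. \<Sum>n\<in>X. f n x) (\<lambda>x. \<Sum>\<^sub>\<infinity>n. f n x) (finite_subsets_at_top UNIV)"
    by (rule Weierstrass_m_test_general[OF bound M])
  have "continuous_on {a..b} (\<lambda>x. \<Sum>n\<in>X. f n x)" for X
    by (intro continuous_on_sum cont)
  then obtain I J where I: "\<And>X. ((\<lambda>x. \<Sum>n\<in>X. f n x) has_integral I X) {a..b}"
      "((\<lambda>x. \<Sum>\<^sub>\<infinity>n. f n x) has_integral J) {a..b}" "(I \<longlongrightarrow> J) (finite_subsets_at_top UNIV)"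
    using uniform_limit_integral[OF lim] by (metis finite_subsets_at_top_neq_bot)
  have "I X = (\<Sum>n\<in>X. integral {a..b} (f n))" if "finite X" for X
    using integral_unique[OF I(1)[of X]] that cont
    by (simp add: integral_sum integrable_continuous_interval)
  hence "((\<lambda>X. \<Sum>n\<in>X. integral {a..b} (f n)) \<longlongrightarrow> J) (finite_subsets_at_top UNIV)"
    using I(3) by (elim Lim_transform_eventually) (auto intro: eventually_finite_subsets_at_top_weakI)
  thus ?thesis
    using integral_unique[OF I(2)] by (simp add: has_sum_def)
qed

lemma continuous_on_infsum:
  fixes f :: "'a \<Rightarrow> 'b :: topological_space \<Rightarrow> 'c :: banach"
  assumes cont: "\<And>n. continuous_on A (f n)"
    and bound: "\<And>n x. x \<in> A \<Longrightarrow> norm (f n x) \<le> M n" and M: "M summable_on UNIV"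
  shows "continuous_on A (\<lambda>x. \<Sum>\<^sub>\<infinity>n. f n x)"
  by (rule uniform_limit_theorem[OF _ Weierstrass_m_test_general[OF bound M]])
     (auto intro!: always_eventually continuous_on_sum cont)

lemma integral_e_of_int:
  "integral {0..1} (\<lambda>x. e (complex_of_real (of_int m * x))) = (if m = 0 then 1 else 0)"
proof (cases "m = 0")
  case False
  define F where "F = (\<lambda>z::complex. exp (2 * of_real pi * \<i> * (of_int m * z)) / (2 * of_real pi * \<i> * of_int m))"
  have int: "((\<lambda>x. e (complex_of_real (of_int m * x))) has_integral F (of_real 1) - F (of_real 0)) {0..1}"
  proof (rule fundamental_theorem_of_calculus)
    fix x :: real
    have "(F has_field_derivative exp (2 * of_real pi * \<i> * (of_int m * of_real x))) (at (of_real x))"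
      unfolding F_def using False by (auto intro!: derivative_eq_intros)
    from has_vector_derivative_real_field[OF this]
    show "((\<lambda>x. F (of_real x)) has_vector_derivative e (complex_of_real (of_int m * x))) (at x within {0..1})"
      by (simp add: e_def)
  qed simp
  have "F (of_real 1) = F (of_real 0)"
    using e_of_int[of m] by (simp add: F_def e_def)
  thus ?thesis using False integral_unique[OF int] by simp
qed simp

text \<open>The lopsided intervals are exactly those tiled by the unit intervals
  \<open>[n, n + 1]\<close> with \<open>|n| <= N\<close>.\<close>

lemma gauss_wave_integral_tendsto:
  assumes s: "s > 0"
  shows "(\<lambda>N. integral {-real N..real N + 1} (gauss_wave s \<xi>)) \<longlonglongrightarrow> of_real (exp (- pi * \<xi>^2 / s) / sqrt s)"
proof -
  have U: "(\<Union>N. {-real N..real N + 1}) = UNIV"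
  proof safe
    fix x :: real
    obtain N where "\<bar>x\<bar> \<le> real N" using real_arch_simple by blast
    thus "x \<in> (\<Union>N. {-real N..real N + 1})" by (auto intro!: exI[of _ N])
  qed auto
  have int: "set_integrable lborel UNIV (gauss_wave s \<xi>)"
    using gauss_wave_fourier(1)[OF s] by (simp add: set_integrable_def)
  have "(\<lambda>N. LINT x:{-real N..real N + 1}|lborel. gauss_wave s \<xi> x) \<longlonglongrightarrow>
           (LINT x:(\<Union>N. {-real N..real N + 1})|lborel. gauss_wave s \<xi> x)"
    using int by (intro set_integral_cont_up) (auto simp: U incseq_def)
  also have "(LINT x:(\<Union>N. {-real N..real N + 1})|lborel. gauss_wave s \<xi> x) = of_real (exp (- pi * \<xi>^2 / s) / sqrt s)"
    unfolding U using gauss_wave_fourier(2)[OF s] by (simp add: set_lebesgue_integral_def)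
  also have "(\<lambda>N. LINT x:{-real N..real N + 1}|lborel. gauss_wave s \<xi> x) = (\<lambda>N. integral {-real N..real N + 1} (gauss_wave s \<xi>))"
  proof
    show "(LINT x:{-real N..real N + 1}|lborel. gauss_wave s \<xi> x) = integral {-real N..real N + 1} (gauss_wave s \<xi>)" for N
      by (intro set_borel_integral_eq_integral(2) set_integrable_subset[OF int]) auto
  qed
  finally show ?thesis .
qed

lemma gauss_wave_sum_intervals:
  "(\<Sum>n\<in>{-int N..int N}. integral {of_int n..of_int n + 1} (gauss_wave s \<xi>)) = integral {-real N..real N + 1} (gauss_wave s \<xi>)"
proof (induction N)
  case (Suc N)
  have int: "gauss_wave s \<xi> integrable_on {a..b}" for a b
    by (intro integrable_continuous_interval continuous_on_gauss_wave)
  have "{-int (Suc N)..int (Suc N)} = insert (int (Suc N)) (insert (- int (Suc N)) {-int N..int N})"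
    by auto
  hence "(\<Sum>n\<in>{-int (Suc N)..int (Suc N)}. integral {of_int n..of_int n + 1} (gauss_wave s \<xi>)) =
     integral {real N + 1..real N + 2} (gauss_wave s \<xi>) + (integral {- 1 - real N..- real N} (gauss_wave s \<xi>)
       + integral {-real N..real N + 1} (gauss_wave s \<xi>))"
    unfolding Suc.IH[symmetric] by (simp add: algebra_simps)
  also have "integral {- 1 - real N..- real N} (gauss_wave s \<xi>)
       + integral {-real N..real N + 1} (gauss_wave s \<xi>) = integral {- 1 - real N..real N + 1} (gauss_wave s \<xi>)"
    by (intro Henstock_Kurzweil_Integration.integral_combine int) auto
  also have "integral {real N + 1..real N + 2} (gauss_wave s \<xi>) + \<dots> = integral {- 1 - real N..real N + 2} (gauss_wave s \<xi>)"
    by (subst add.commute, intro Henstock_Kurzweil_Integration.integral_combine int) auto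
  finally show ?case by (simp add: algebra_simps)
qed simp

text \<open>Because \<open>e (k n) = 1\<close>, the factor \<open>e (k u)\<close> equals
  \<open>e (k (n + u))\<close>. The product thus depends on \<open>n\<close> and \<open>u\<close>
  only through \<open>n + u\<close>, which makes unfolding possible.\<close>

lemma theta_term_mult_e:
  "theta_term u v (\<i> * of_real s) n * e (complex_of_real (of_int k * u)) = gauss_wave s (v + of_int k) (of_int n + u)"
proof -
  have "theta_term u v (\<i> * of_real s) n * e (complex_of_real (of_int k * u)) =
        theta_term u v (\<i> * of_real s) n * e (complex_of_real (of_int k * u) + of_int (k * n))"
    unfolding e_add by (simp only: e_of_int mult_1_right)
  also have "\<dots> = gauss_wave s (v + of_int k) (of_int n + u)"
    unfolding theta_term_def gauss_wave_def e_add[symmetric]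
    by (rule arg_cong[where f = e]) (simp add: algebra_simps)
  finally show ?thesis .
qed

text \<open>Unfolding: the integrals over \<open>[0, 1]\<close> of the integer translates add up to
  the integral of one Gaussian wave over the whole line.\<close>

lemma theta_char_fourier_coeff:
  assumes s: "s > 0"
  shows "integral {0..1} (\<lambda>u. theta_char u v (\<i> * of_real s) * e (complex_of_real (of_int k * u))) =
     of_real (exp (- pi * (v + of_int k)^2 / s) / sqrt s)"
proof -
  define \<xi> where "\<xi> = v + of_int k"
  have "((\<lambda>n. integral {0..1} (\<lambda>u. gauss_wave s \<xi> (of_int n + u))) has_sum
       integral {0..1} (\<lambda>u. \<Sum>\<^sub>\<infinity>n. gauss_wave s \<xi> (of_int n + u))) (UNIV :: int set)"
  proof (rule has_sum_integral[OF _ _ summable_theta_bound[OF s]])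
    show "continuous_on {0..1} (\<lambda>u. gauss_wave s \<xi> (of_int n + u))" for n :: int
      unfolding gauss_wave_def by (intro continuous_intros) auto
    show "norm (gauss_wave s \<xi> (of_int n + u)) \<le> exp (pi * s * 1\<^sup>2) * exp (- pi * s / 2) ^ nat \<bar>n\<bar>"
      if "u \<in> {0..1}" for n :: int and u
      using norm_theta_term_le[of s "\<i> * of_real s" u 1 v n] s that
      unfolding \<xi>_def theta_term_mult_e[symmetric] by (simp add: norm_mult norm_e)
  qed
  moreover have "integral {0..1} (\<lambda>u. gauss_wave s \<xi> (of_int n + u)) = integral {of_int n..of_int n + 1} (gauss_wave s \<xi>)" for n :: int
    using integral_shift[of 0 "of_int n" 1 "gauss_wave s \<xi>"] continuous_on_gauss_wave
    by (simp add: o_def add_ac)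
  moreover have "(\<Sum>\<^sub>\<infinity>n. gauss_wave s \<xi> (of_int n + u)) = theta_char u v (\<i> * of_real s) * e (complex_of_real (of_int k * u))" for u
    unfolding theta_char_def \<xi>_def theta_term_mult_e[symmetric] by (rule infsum_cmult_left')
  ultimately have "((\<lambda>n::int. integral {of_int n..of_int n + 1} (gauss_wave s \<xi>)) has_sum
     integral {0..1} (\<lambda>u. theta_char u v (\<i> * of_real s) * e (complex_of_real (of_int k * u)))) UNIV"
    by simp
  from has_sum_int_imp_tendsto[OF this] gauss_wave_integral_tendsto[OF s, of \<xi>] show ?thesis
    unfolding gauss_wave_sum_intervals \<xi>_def using LIMSEQ_unique by blast
qed

lemma theta_char_periodic: "theta_char (u + 1) v \<tau> = theta_char u v \<tau>"
  unfolding theta_char_def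
  by (rule infsum_reindex_bij_witness[of _ "\<lambda>n. n - 1" "\<lambda>n. n + 1"])
     (simp_all add: theta_term_def add_ac)

text \<open>The majorant depends on a bound for \<open>u\<close>, so the uniform convergence is used
  on unit balls only.\<close>

lemma continuous_on_theta_char_u:
  assumes "Im \<tau> > 0"
  shows "continuous_on UNIV (\<lambda>u. theta_char u v \<tau>)"
proof -
  have "isCont (\<lambda>u. theta_char u v \<tau>) x" for x
  proof -
    have "continuous_on (ball x 1) (\<lambda>u. theta_char u v \<tau>)"
      unfolding theta_char_def
    proof (rule continuous_on_infsum[OF _ _ summable_theta_bound[OF assms]])
      show "continuous_on (ball x 1) (\<lambda>u. theta_term u v \<tau> n)" for n
        unfolding theta_term_def by (intro continuous_intros) auto
      show "norm (theta_term u v \<tau> n) \<le> exp (pi * Im \<tau> * (\<bar>x\<bar> + 1)\<^sup>2) * exp (- pi * Im \<tau> / 2) ^ nat \<bar>n\<bar>"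
        if "u \<in> ball x 1" for n u
        using that assms by (intro norm_theta_term_le) (auto simp: dist_real_def)
    qed
    thus ?thesis by (simp add: continuous_on_eq_continuous_at)
  qed
  thus ?thesis by (simp add: continuous_on_eq_continuous_at)
qed

text \<open>Poisson summation: both sides are continuous and 1-periodic in \<open>u\<close> and have
  the same Fourier coefficients.\<close>

lemma theta_char_imag:
  assumes s: "s > 0"
  shows "theta_char u v (\<i> * of_real s) = of_real (1 / sqrt s) * e (complex_of_real (u * v)) * theta_char (-v) u (\<i> / of_real s)"
proof -
  \<comment> \<open>The factor \<open>e (u v)\<close> makes each term periodic:
    \<open>(k - v) u + u v = k u\<close>, so \<open>F\<close> below is a Fourier series with
    coefficients \<open>a k\<close>.\<close>
  define g where "g = (\<lambda>k u. e (complex_of_real (u * v)) * theta_term (-v) u (\<i> / of_real s) k)"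
  define a where "a = (\<lambda>k::int. complex_of_real (exp (- pi * (of_int k - v)^2 / s)))"
  have Im: "Im (\<i> / of_real s) = 1 / s" using s by (simp add: Im_divide_of_real)
  have pos: "1 / s > 0" using s by simp
  have g_eq: "g k u = a k * e (complex_of_real (of_int k * u))" for k u
    by (simp add: g_def a_def theta_term_def e_def exp_add[symmetric] exp_of_real[symmetric])
       (rule arg_cong[where f = exp], use s in \<open>simp add: field_simps\<close>)
  have norm_g: "norm (g k u) \<le> exp (pi * (1 / s) * \<bar>v\<bar>\<^sup>2) * exp (- pi * (1 / s) / 2) ^ nat \<bar>k\<bar>" for k u
    using norm_theta_term_le[of "1 / s" "\<i> / of_real s" "-v" "\<bar>v\<bar>" u k] pos Im
    by (simp add: g_def norm_mult norm_e)
  have cont_g: "continuous_on A (g k)" for k A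
    unfolding g_eq[abs_def] by (intro continuous_intros)
  define F where "F = (\<lambda>u. \<Sum>\<^sub>\<infinity>k. g k u)"
  have F_eq: "F u = e (complex_of_real (u * v)) * theta_char (-v) u (\<i> / of_real s)" for u
    unfolding F_def g_def theta_char_def by (rule infsum_cmult_right')
  have F_cont: "continuous_on UNIV F"
    unfolding F_def by (rule continuous_on_infsum[OF cont_g norm_g summable_theta_bound[OF pos]])
  have g_per: "g k (u + 1) = g k u" for k u
    by (simp add: g_eq distrib_left e_add)
  have F_per: "F (u + 1) = F u" for u
    by (simp add: F_def g_per)
  \<comment> \<open>Coefficients are taken against \<open>e (j u)\<close> without conjugation, hence
    the index \<open>- j\<close>.\<close>
  have F_coeff: "integral {0..1} (\<lambda>u. F u * e (complex_of_real (of_int j * u))) = a (- j)" for j :: int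
  proof -
    have "((\<lambda>k. integral {0..1} (\<lambda>u. g k u * e (complex_of_real (of_int j * u)))) has_sum
       integral {0..1} (\<lambda>u. \<Sum>\<^sub>\<infinity>k. g k u * e (complex_of_real (of_int j * u)))) UNIV"
    proof (rule has_sum_integral[OF _ _ summable_theta_bound[OF pos]])
      show "continuous_on {0..1} (\<lambda>u. g k u * e (complex_of_real (of_int j * u)))" for k
        by (intro continuous_intros cont_g)
      show "norm (g k u * e (complex_of_real (of_int j * u))) \<le> exp (pi * (1 / s) * \<bar>v\<bar>\<^sup>2) * exp (- pi * (1 / s) / 2) ^ nat \<bar>k\<bar>" for k u
        using norm_g[of k u] by (simp add: norm_mult norm_e)
    qed
    moreover have "integral {0..1} (\<lambda>u. g k u * e (complex_of_real (of_int j * u))) = (if k = - j then a k else 0)" for k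
    proof -
      have "(\<lambda>u. g k u * e (complex_of_real (of_int j * u))) = (\<lambda>u. a k * e (complex_of_real (of_int (k + j) * u)))"
        by (simp add: g_eq fun_eq_iff e_add distrib_right)
      thus ?thesis using integral_e_of_int[of "k + j"] by auto
    qed
    moreover have "(\<Sum>\<^sub>\<infinity>k. g k u * e (complex_of_real (of_int j * u))) = F u * e (complex_of_real (of_int j * u))" for u
      unfolding F_def by (rule infsum_cmult_left')
    ultimately have "((\<lambda>k. if k = - j then a k else 0) has_sum integral {0..1} (\<lambda>u. F u * e (complex_of_real (of_int j * u)))) UNIV"
      by simp
    moreover have "((\<lambda>k. if k = - j then a k else 0) has_sum a (- j)) UNIV"
      by (rule has_sum_finite_neutralI[of "{- j}"]) auto
    ultimately show ?thesis by (rule has_sum_unique)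
  qed
  define h where "h = (\<lambda>u. theta_char u v (\<i> * of_real s) - of_real (1 / sqrt s) * F u)"
  have th_cont: "continuous_on UNIV (\<lambda>u. theta_char u v (\<i> * of_real s))"
    using s by (intro continuous_on_theta_char_u) auto
  have "h u = 0"
  proof (rule fourier_uniqueness)
    show "continuous_on UNIV h"
      unfolding h_def by (intro continuous_on_diff continuous_on_mult continuous_on_const th_cont F_cont)
    show "h (x + 1) = h x" for x
      by (simp add: h_def theta_char_periodic F_per)
    fix k :: int
    have 1: "(\<lambda>u. theta_char u v (\<i> * of_real s) * e (complex_of_real (of_int k * u))) integrable_on {0..1}"
      using th_cont by (intro integrable_continuous_interval continuous_on_mult continuous_on_e)
        (auto intro: continuous_on_subset intro!: continuous_intros)
    have 2: "(\<lambda>u. F u * e (complex_of_real (of_int k * u))) integrable_on {0..1}"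
      using F_cont by (intro integrable_continuous_interval continuous_on_mult continuous_on_e)
        (auto intro: continuous_on_subset intro!: continuous_intros)
    have "integral {0..1} (\<lambda>x. h x * e (complex_of_real (of_int k * x))) =
      integral {0..1} (\<lambda>u. theta_char u v (\<i> * of_real s) * e (complex_of_real (of_int k * u)) -
         of_real (1 / sqrt s) * (F u * e (complex_of_real (of_int k * u))))"
      by (simp only: h_def left_diff_distrib mult.assoc)
    also have "\<dots> = of_real (exp (- pi * (v + of_int k)^2 / s) / sqrt s) - of_real (1 / sqrt s) * a (- k)"
      using integral_diff[OF 1 integrable_on_cmult_left[OF 2, of "1 / sqrt s"]]
      by (simp only: integral_mult_right theta_char_fourier_coeff[OF s] F_coeff)
    also have "a (- k) = of_real (exp (- pi * (v + of_int k)^2 / s))"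
      by (simp add: a_def power2_eq_square algebra_simps)
    finally show "integral {0..1} (\<lambda>x. h x * e (complex_of_real (of_int k * x))) = 0" by simp
  qed
  thus ?thesis by (simp add: h_def F_eq)
qed

lemma uhp_neg_inverse: "\<tau> \<in> uhp \<Longrightarrow> - 1 / \<tau> \<in> uhp"
  by (simp add: uhp_def Im_divide divide_less_0_iff sum_power2_gt_zero_iff)

lemma neg_i_mult_uhp: "\<tau> \<in> uhp \<Longrightarrow> - \<i> * \<tau> \<notin> \<real>\<^sub>\<le>\<^sub>0"
  by (auto simp: uhp_def complex_nonpos_Reals_iff)

text \<open>Both sides are holomorphic on \<open>uhp\<close>, since \<open>- \<i> * \<tau>\<close>
  avoids the cut of \<open>csqrt\<close>, and they agree on the positive imaginary axis
  \<open>U\<close>.\<close>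

lemma theta_char_neg_inverse:
  assumes \<tau>: "\<tau> \<in> uhp"
  shows "theta_char u v (- 1 / \<tau>) = csqrt (- \<i> * \<tau>) * e (complex_of_real (u * v)) * theta_char (-v) u \<tau>"
proof -
  define D where "D = (\<lambda>\<tau>. theta_char u v (- 1 / \<tau>) - csqrt (- \<i> * \<tau>) * e (complex_of_real (u * v)) * theta_char (-v) u \<tau>)"
  define U where "U = (\<lambda>t. \<i> * complex_of_real t) ` {0<..}"
  have "D \<tau> = 0"
  proof (rule analytic_continuation[OF _ open_uhp connected_uhp, of D U \<i>])
    have "(theta_char u v \<circ> (\<lambda>\<tau>. - 1 / \<tau>)) holomorphic_on uhp"
    proof (rule holomorphic_on_compose_gen[OF _ theta_char_holomorphic])
      show "(\<lambda>\<tau>. - 1 / \<tau>) holomorphic_on uhp"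
        by (intro holomorphic_intros) (auto simp: uhp_def)
    qed (intro image_subsetI uhp_neg_inverse)
    thus "D holomorphic_on uhp"
      unfolding D_def using neg_i_mult_uhp
      by (auto intro!: holomorphic_intros theta_char_holomorphic simp: o_def)
    show "U \<subseteq> uhp" "\<i> \<in> uhp" by (auto simp: U_def uhp_def)
    show "\<i> islimpt U"
      unfolding islimpt_approachable
    proof (intro allI impI)
      fix \<epsilon> :: real assume \<epsilon>: "\<epsilon> > 0"
      have "dist (\<i> * of_real (1 + \<epsilon> / 2)) \<i> = \<epsilon> / 2"
        using \<epsilon> by (simp add: dist_norm ring_distribs norm_mult)
      thus "\<exists>x'\<in>U. x' \<noteq> \<i> \<and> dist x' \<i> < \<epsilon>"
        using \<epsilon> by (intro bexI[of _ "\<i> * of_real (1 + \<epsilon> / 2)"]) (auto simp: U_def complex_eq_iff)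
    qed
    fix z assume "z \<in> U"
    then obtain t where t: "t > 0" "z = \<i> * of_real t" by (auto simp: U_def)
    \<comment> \<open>At \<open>z = \<i> t\<close> the formula on the axis is applied with
      \<open>s = 1 / t\<close>, so that \<open>1 / sqrt s\<close> becomes
      \<open>sqrt t\<close>.\<close>
    have "- 1 / z = \<i> * of_real (1 / t)" using t by (simp add: field_simps)
    moreover have "csqrt (- \<i> * z) = of_real (sqrt t)"
      using t csqrt_of_real_nonneg[of "of_real t"] by (simp add: algebra_simps)
    moreover have "\<i> / of_real (1 / t) = z" using t by simp
    ultimately show "D z = 0"
      unfolding D_def using theta_char_imag[of "1 / t" u v] t by (simp add: real_sqrt_divide)
  qed (use \<tau> in auto)
  thus ?thesis by (simp add: D_def)
qed

section \<open>The eta function as a theta series\<close>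

lemma e_cong_int: "x - y = of_int n \<Longrightarrow> e x = e y"
  by (rule e_cong_Ints) simp

section \<open>Symmetry and shift rules for the characteristics\<close>

lemma theta_char_neg: "theta_char (- u) (- v) \<tau> = theta_char u v \<tau>"
  unfolding theta_char_def
  by (rule infsum_reindex_bij_witness[of _ uminus uminus])
     (simp_all add: theta_term_def power2_eq_square algebra_simps)

lemma theta_char_u_shift: "theta_char (u + of_int m) v \<tau> = theta_char u v \<tau>"
  by (rule periodic_of_int[where h = "\<lambda>u. theta_char u v \<tau>", OF theta_char_periodic])

lemma theta_char_v_shift:
  "theta_char u (v + of_int m) \<tau> = e (complex_of_real (u * of_int m)) * theta_char u v \<tau>"
proof -
  have "theta_term u (v + of_int m) \<tau> n = e (complex_of_real (u * of_int m)) * theta_term u v \<tau> n" for n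
    unfolding theta_term_def e_add[symmetric]
  proof (rule e_cong_int)
    show "complex_of_real ((of_int n + u)^2 / 2) * \<tau> + complex_of_real ((of_int n + u) * (v + of_int m)) -
      (complex_of_real (u * of_int m) + (complex_of_real ((of_int n + u)^2 / 2) * \<tau> + complex_of_real ((of_int n + u) * v)))
      = of_int (n * m)"
      by (simp add: algebra_simps)
  qed
  thus ?thesis unfolding theta_char_def by (subst infsum_cmult_right'[symmetric]) (rule infsum_cong)
qed

text \<open>Modulo integers the quadratic phase is linear: \<open>(n + u)^2 / 2 = (n + u) (u + 1/2)
  - u (u + 1) / 2 + n (n - 1) / 2\<close>, and the last term is an integer.\<close>

lemma theta_char_plus_one:
  "theta_char u v (\<tau> + 1) = e (complex_of_real (- u * (u + 1) / 2)) * theta_char u (v + u + 1/2) \<tau>"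
proof -
  have "theta_term u v (\<tau> + 1) n = e (complex_of_real (- u * (u + 1) / 2)) * theta_term u (v + u + 1/2) \<tau> n" for n
    unfolding theta_term_def e_add[symmetric]
  proof (rule e_cong_int)
    define N where "N = n * (n - 1) div 2"
    have "2 * N = n * (n - 1)" by (simp add: N_def)
    hence "2 * complex_of_int N = of_int n * (of_int n - 1)"
      by (metis of_int_1 of_int_diff of_int_mult of_int_numeral)
    hence N: "complex_of_int N = of_int n * (of_int n - 1) / 2" by (simp add: field_simps)
    show "complex_of_real ((of_int n + u)^2 / 2) * (\<tau> + 1) + complex_of_real ((of_int n + u) * v) -
      (complex_of_real (- u * (u + 1) / 2) + (complex_of_real ((of_int n + u)^2 / 2) * \<tau> + complex_of_real ((of_int n + u) * (v + u + 1/2))))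
      = of_int N"
      unfolding N by (simp add: field_simps power2_eq_square)
  qed
  thus ?thesis unfolding theta_char_def by (subst infsum_cmult_right'[symmetric]) (rule infsum_cong)
qed

lemma of_nat_sum_atMost: "of_nat (\<Sum>{..m}) = (of_nat m * (of_nat m + 1) / 2 :: 'a :: field_char_0)"
  by (induction m) (simp_all add: field_simps)

text \<open>Completing the square, \<open>3 (m + 1/6)^2 / 2 = m (3 m + 1) / 2 + 1/24\<close>. The
  sign is \<open>e (m / 2)\<close>, and \<open>e (- 1 / 12)\<close> cancels the remaining phase
  \<open>e (1/6 * 1/2)\<close>.\<close>

lemma eta_term_pos:
  "e (- 1 / 12) * theta_term (1/6) (1/2) (3 * \<tau>) (int m) = e (\<tau> / 24) * ((-1) ^ m * e \<tau> ^ (m * m + \<Sum>{..m}))"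
proof -
  have "(-1) ^ m * e \<tau> ^ (m * m + \<Sum>{..m}) = e (of_nat m * (1/2)) * e (of_nat (m * m + \<Sum>{..m}) * \<tau>)"
    by (simp only: e_of_nat_mult e_half)
  thus ?thesis
    unfolding theta_term_def
    by (simp only: e_add[symmetric] of_nat_add of_nat_sum_atMost)
       (rule arg_cong[where f = e], simp add: field_simps power2_eq_square)
qed

lemma eta_term_neg:
  "e (- 1 / 12) * theta_term (1/6) (1/2) (3 * \<tau>) (- int (Suc k)) =
     e (\<tau> / 24) * ((-1) ^ Suc k * e \<tau> ^ (Suc k * Suc k + \<Sum>{..k}))"
proof -
  define K where "K = (of_nat (Suc k) :: complex)"
  have k: "of_nat k = K - 1" by (simp add: K_def)
  have "(-1) ^ Suc k * e \<tau> ^ (Suc k * Suc k + \<Sum>{..k}) = e (of_nat (Suc k) * (1/2)) * e (of_nat (Suc k * Suc k + \<Sum>{..k}) * \<tau>)"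
    by (simp only: e_of_nat_mult e_half)
  also have "of_nat (Suc k * Suc k + \<Sum>{..k}) = K * K + (K - 1) * K / 2"
    by (simp only: of_nat_add of_nat_mult of_nat_sum_atMost k K_def[symmetric] diff_add_cancel)
  finally have "(-1) ^ Suc k * e \<tau> ^ (Suc k * Suc k + \<Sum>{..k}) = e (K * (1/2)) * e ((K * K + (K - 1) * K / 2) * \<tau>)"
    by (simp only: K_def)
  hence "e (\<tau> / 24) * ((-1) ^ Suc k * e \<tau> ^ (Suc k * Suc k + \<Sum>{..k})) =
     e (\<tau> / 24 + (K * (1/2) + (K * K + (K - 1) * K / 2) * \<tau>))"
    by (simp only: e_add)
  also have "\<dots> = e (- 1 / 12) * theta_term (1/6) (1/2) (3 * \<tau>) (- int (Suc k))"
    unfolding theta_term_def e_add[symmetric]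
  proof (rule e_cong_int)
    have K': "complex_of_int (- int (Suc k)) = - K" by (simp add: K_def)
    \<comment> \<open>The sign is \<open>e (K / 2)\<close> on one side and
      \<open>e (- K / 2)\<close> on the other, whence the integral difference
      \<open>K\<close>.\<close>
    show "\<tau> / 24 + (K * (1/2) + (K * K + (K - 1) * K / 2) * \<tau>) -
       (- 1 / 12 + (complex_of_real ((of_int (- int (Suc k)) + 1/6)^2 / 2) * (3 * \<tau>)
         + complex_of_real ((of_int (- int (Suc k)) + 1/6) * (1/2)))) = of_int (int (Suc k))"
      unfolding of_int_of_nat_eq K_def[symmetric] of_real_mult of_real_divide of_real_power of_real_add of_real_of_int_eq K'
      by (simp add: field_simps power2_eq_square)
  qed
  finally show ?thesis ..
qed

text \<open>The indices \<open>Suc k\<close> and \<open>- Suc k\<close> of the theta series give the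
  two pentagonal terms number \<open>k\<close>, so symmetric partial sums match those of the product
  expansion.\<close>

lemma eta_eq_theta_char:
  assumes \<tau>: "\<tau> \<in> uhp"
  shows "eta \<tau> = e (- 1 / 12) * theta_char (1/6) (1/2) (3 * \<tau>)" and eta_nonzero: "eta \<tau> \<noteq> 0"
proof -
  define q where "q = e \<tau>"
  have q: "norm q < 1" using \<tau> by (simp add: q_def norm_e uhp_def)
  have eta: "eta \<tau> = e (\<tau> / 24) * (\<Prod>k. 1 - q ^ Suc k)"
    unfolding eta_def q_def by (simp only: e_of_nat_mult)
  show "eta \<tau> \<noteq> 0"
    unfolding eta using pentagonal_tendsto(2)[OF q] by simp
  define s where "s = (\<lambda>k. e (- 1 / 12) * theta_term (1/6) (1/2) (3 * \<tau>) k)"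
  define P where "P = (\<lambda>n. 1 + (\<Sum>k<n. (-1)^Suc k * (q ^ (Suc k * Suc k + \<Sum>{..Suc k}) + q ^ (Suc k * Suc k + \<Sum>{..k}))))"
  have "(\<Sum>k\<in>{-int n..int n}. s k) = e (\<tau> / 24) * P n" for n
  proof (induction n)
    case 0
    show ?case using eta_term_pos[of \<tau> 0] by (simp add: s_def P_def)
  next
    case (Suc n)
    have "{-int (Suc n)..int (Suc n)} = insert (int (Suc n)) (insert (- int (Suc n)) {-int n..int n})"
      by auto
    hence "(\<Sum>k\<in>{-int (Suc n)..int (Suc n)}. s k) = s (int (Suc n)) + (s (- int (Suc n)) + e (\<tau> / 24) * P n)"
      using Suc.IH by simp
    also have "\<dots> = e (\<tau> / 24) * P (Suc n)"
      unfolding s_def eta_term_pos eta_term_neg P_def q_def sum.lessThan_Suc by (simp only: ring_distribs ac_simps)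
    finally show ?case .
  qed
  moreover have "(s has_sum e (- 1 / 12) * theta_char (1/6) (1/2) (3 * \<tau>)) UNIV"
    unfolding s_def using \<tau> by (intro has_sum_cmult_right theta_char_has_sum) (simp add: uhp_def)
  ultimately have "(\<lambda>n. e (\<tau> / 24) * P n) \<longlonglongrightarrow> e (- 1 / 12) * theta_char (1/6) (1/2) (3 * \<tau>)"
    using has_sum_int_imp_tendsto by fastforce
  moreover have "(\<lambda>n. e (\<tau> / 24) * P n) \<longlonglongrightarrow> eta \<tau>"
    unfolding eta P_def by (intro tendsto_mult tendsto_const pentagonal_tendsto(1)[OF q])
  ultimately show "eta \<tau> = e (- 1 / 12) * theta_char (1/6) (1/2) (3 * \<tau>)"
    using LIMSEQ_unique by blast
qed

lemma infsum_int_mod_3: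
  fixes f :: "int \<Rightarrow> 'a :: banach"
  assumes "f summable_on UNIV"
  shows "(\<Sum>\<^sub>\<infinity>n. f n) = (\<Sum>\<^sub>\<infinity>m. f (3 * m)) + (\<Sum>\<^sub>\<infinity>m. f (3 * m + 1)) + (\<Sum>\<^sub>\<infinity>m. f (3 * m + 2))"
proof -
  define R where "R = (\<lambda>j. range (\<lambda>m::int. 3 * m + j))"
  have R: "infsum f (R j) = (\<Sum>\<^sub>\<infinity>m. f (3 * m + j))" for j
    unfolding R_def by (subst infsum_reindex) (auto simp: inj_on_def o_def)
  have sm: "f summable_on A" for A
    using assms by (rule summable_on_subset_banach) simp
  have "n \<in> R 0 \<union> R 1 \<union> R 2" for n
  proof -
    have "n \<in> R (n mod 3)"
      unfolding R_def by (rule image_eqI[of _ _ "n div 3"]) simp_all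
    moreover have "n mod 3 = 0 \<or> n mod 3 = 1 \<or> n mod 3 = 2" by presburger
    ultimately show ?thesis by (elim disjE) simp_all
  qed
  hence UN: "R 0 \<union> R 1 \<union> R 2 = UNIV" by blast
  have ne: "3 * m + 0 \<noteq> 3 * m' + 1" "3 * m + 0 \<noteq> 3 * m' + 2" "3 * m + 1 \<noteq> 3 * m' + 2" for m m' :: int
    by presburger+
  have "infsum f (R 0 \<union> R 1 \<union> R 2) = infsum f (R 0 \<union> R 1) + infsum f (R 2)"
    by (rule infsum_Un_disjoint[OF sm sm]) (use ne in \<open>unfold R_def, blast\<close>)
  also have "infsum f (R 0 \<union> R 1) = infsum f (R 0) + infsum f (R 1)"
    by (rule infsum_Un_disjoint[OF sm sm]) (use ne in \<open>unfold R_def, blast\<close>)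
  finally show ?thesis unfolding R UN by simp
qed

text \<open>Inversion carries the theta series of \<open>eta\<close> to this one. Splitting
  \<open>n\<close> modulo 3 leads back to argument \<open>3 * \<tau>\<close>: two classes give
  \<open>eta\<close> with phases \<open>e (1/12)\<close> and \<open>e (- 1/12)\<close>, whose sum is
  \<open>2 cos (pi / 6) = sqrt 3\<close>, and the third vanishes.\<close>

lemma theta_char_third:
  assumes \<tau>: "\<tau> \<in> uhp"
  shows "theta_char (- 1/2) (1/6) (\<tau> / 3) = of_real (sqrt 3) * eta \<tau>"
proof -
  have "theta_char (- 1/2) (1/6) (\<tau> / 3) = (\<Sum>\<^sub>\<infinity>m. theta_term (- 1/2) (1/6) (\<tau> / 3) (3 * m)) +
     (\<Sum>\<^sub>\<infinity>m. theta_term (- 1/2) (1/6) (\<tau> / 3) (3 * m + 1)) + (\<Sum>\<^sub>\<infinity>m. theta_term (- 1/2) (1/6) (\<tau> / 3) (3 * m + 2))"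
    unfolding theta_char_def using \<tau>
    by (intro infsum_int_mod_3 theta_term_summable) (simp add: uhp_def)
  moreover have "theta_term (- 1/2) (1/6) (\<tau> / 3) (3 * m) = theta_term (- 1/6) (1/2) (3 * \<tau>) m" for m
    unfolding theta_term_def by (rule arg_cong[where f = e]) (simp add: field_simps power2_eq_square)
  moreover have "theta_term (- 1/2) (1/6) (\<tau> / 3) (3 * m + 1) = theta_term (1/6) (1/2) (3 * \<tau>) m" for m
    unfolding theta_term_def by (rule arg_cong[where f = e]) (simp add: field_simps power2_eq_square)
  moreover have "theta_term (- 1/2) (1/6) (\<tau> / 3) (3 * m + 2) = theta_term (1/2) (1/2) (3 * \<tau>) m" for m
    unfolding theta_term_def by (rule arg_cong[where f = e]) (simp add: field_simps power2_eq_square)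
  ultimately have sum: "theta_char (- 1/2) (1/6) (\<tau> / 3) =
      theta_char (- 1/6) (1/2) (3 * \<tau>) + theta_char (1/6) (1/2) (3 * \<tau>) + theta_char (1/2) (1/2) (3 * \<tau>)"
    by (simp only: theta_char_def)
  have eta: "theta_char (1/6) (1/2) (3 * \<tau>) = e (1/12) * eta \<tau>"
    unfolding eta_eq_theta_char(1)[OF \<tau>] by (simp add: e_minus)
  have "theta_char (- 1/6) (1/2) (3 * \<tau>) = e (- 1/6) * theta_char (1/6) (1/2) (3 * \<tau>)"
    using theta_char_neg[of "1/6" "-1/2" "3 * \<tau>"] theta_char_v_shift[of "1/6" "1/2" "-1" "3 * \<tau>"] by simp
  also have "\<dots> = e (- 1/12) * eta \<tau>"
    unfolding eta by (simp add: e_add[symmetric] flip: mult.assoc)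
  finally have neg: "theta_char (- 1/6) (1/2) (3 * \<tau>) = e (- 1/12) * eta \<tau>" .
  \<comment> \<open>Reflection followed by integral shifts returns the same characteristics with
    factor \<open>- 1\<close>: the series is its own negative.\<close>
  have "theta_char (1/2) (1/2) (3 * \<tau>) = e (- 1/2) * theta_char (1/2) (1/2) (3 * \<tau>)"
    using theta_char_neg[of "1/2" "1/2" "3 * \<tau>"] theta_char_u_shift[of "-1/2" 1 "-1/2" "3 * \<tau>"]
      theta_char_v_shift[of "1/2" "1/2" "-1" "3 * \<tau>"] by simp
  moreover have "e (- 1/2) = - 1"
    using e_minus[of "1/2"] by (simp add: e_half)
  ultimately have zero: "theta_char (1/2) (1/2) (3 * \<tau>) = 0"
    by simp
  have "e (1/12) = cis (pi / 6)" "e (- 1/12) = cis (- pi / 6)"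
    by (simp_all add: e_def cis_conv_exp mult_ac)
  hence "e (1/12) + e (- 1/12) = of_real (sqrt 3)"
    by (simp add: complex_eq_iff cos_30 sin_30)
  hence "of_real (sqrt 3) * eta \<tau> = (e (1/12) + e (- 1/12)) * eta \<tau>" by simp
  thus ?thesis
    unfolding sum neg eta zero by (simp add: distrib_right)
qed

text \<open>Since \<open>3 * (- 1 / \<tau>) = - 1 / (\<tau> / 3)\<close>, theta inversion applies at
  \<open>\<tau> / 3\<close>; the resulting \<open>1 / sqrt 3\<close> cancels against
  \<open>theta_char_third\<close>.\<close>

lemma eta_neg_inverse:
  assumes \<tau>: "\<tau> \<in> uhp"
  shows "eta (- 1 / \<tau>) = csqrt (- \<i> * \<tau>) * eta \<tau>"
proof -
  have \<tau>3: "\<tau> / 3 \<in> uhp" using \<tau> by (simp add: uhp_def)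
  define w where "w = csqrt (- \<i> * \<tau>)"
  have "0 < Re w \<or> Re w = 0 \<and> 0 \<le> Im w"
    unfolding w_def by (rule csqrt_principal)
  hence sqrt: "csqrt (- \<i> * (\<tau> / 3)) = w / of_real (sqrt 3)"
    by (intro csqrt_unique) (auto simp: w_def[THEN arg_cong, of "\<lambda>z. z^2"] power_divide simp flip: of_real_power)
  have "eta (- 1 / \<tau>) = e (- 1/12) * theta_char (1/6) (1/2) (- 1 / (\<tau> / 3))"
    using eta_eq_theta_char(1)[OF uhp_neg_inverse[OF \<tau>]] by simp
  also have "\<dots> = e (- 1/12) * e (1/12) * csqrt (- \<i> * (\<tau> / 3)) * theta_char (- 1/2) (1/6) (\<tau> / 3)"
    using theta_char_neg_inverse[OF \<tau>3, of "1/6" "1/2"] by simp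
  also have "\<dots> = w * eta \<tau>"
    unfolding theta_char_third[OF \<tau>] sqrt by (simp add: e_add[symmetric])
  finally show ?thesis by (simp only: w_def)
qed

lemma eta_plus_one: "eta (\<tau> + 1) = e (1/24) * eta \<tau>"
proof -
  have "e (of_nat (Suc k) * (\<tau> + 1)) = e (of_nat (Suc k) * \<tau>)" for k
    using e_of_int[of "int (Suc k)"] by (simp only: distrib_left e_add mult_1_right of_int_of_nat_eq)
  thus ?thesis
    by (simp add: eta_def add_divide_distrib e_add)
qed

section \<open>Transformation under the modular group\<close>

text \<open>This is \<open>\<Phi>\<^bsub>r\<^esub>\<close>. The exponent is chosen so that the multipliers of \<open>T\<close> and \<open>S\<close> do not depend
  on \<open>r\<close>.\<close>
definition theta_normal :: "real \<Rightarrow> real \<Rightarrow> complex \<Rightarrow> complex" where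
  "theta_normal r1 r2 \<tau> = e (complex_of_real ((r1 * r2 - r2) / 2)) * theta_r r1 r2 \<tau>"

lemma theta_normal_plus_one: "theta_normal r1 r2 (\<tau> + 1) = e (1/8) * theta_normal (r1 - r2) r2 \<tau>"
proof -
  have "theta_char (r2 + 1/2) (1/2 - r1 + (r2 + 1/2) + 1/2) \<tau> =
      e (complex_of_real (r2 + 1/2)) * theta_char (r2 + 1/2) (1/2 - (r1 - r2)) \<tau>"
    using theta_char_v_shift[of "r2 + 1/2" "1/2 - (r1 - r2)" 1 \<tau>] by (simp add: algebra_simps)
  hence "theta_normal r1 r2 (\<tau> + 1) = e (complex_of_real ((r1 * r2 - r2) / 2)) * e (complex_of_real (- (r2 + 1/2) * (r2 + 1/2 + 1) / 2))
      * e (complex_of_real (r2 + 1/2)) * theta_char (r2 + 1/2) (1/2 - (r1 - r2)) \<tau>"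
    unfolding theta_normal_def theta_r_eq theta_char_plus_one by (simp only: mult.assoc)
  also have "\<dots> = e (1/8) * e (complex_of_real (((r1 - r2) * r2 - r2) / 2)) * theta_char (r2 + 1/2) (1/2 - (r1 - r2)) \<tau>"
    unfolding e_add[symmetric]
    by (rule arg_cong[where f = "\<lambda>x. e x * _"]) (simp add: field_simps)
  finally show ?thesis by (simp add: theta_normal_def theta_r_eq mult.assoc)
qed

lemma theta_normal_neg_inverse:
  assumes \<tau>: "\<tau> \<in> uhp"
  shows "theta_normal r1 r2 (- 1 / \<tau>) = e (- 1/4) * csqrt (- \<i> * \<tau>) * theta_normal r2 (- r1) \<tau>"
proof -
  \<comment> \<open>Inversion yields the characteristics \<open>- v\<close>, \<open>u\<close>; a
    reflection and one unit shift bring them to those of \<open>theta_r r2 (- r1)\<close>.\<close>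
  have "theta_char (- (1/2 - r1)) (r2 + 1/2) \<tau> = theta_char (1/2 - r1) (- 1/2 - r2) \<tau>"
    using theta_char_neg[of "1/2 - r1" "- 1/2 - r2" \<tau>] by (simp add: add.commute)
  also have "\<dots> = e (complex_of_real (- (1/2 - r1))) * theta_char (- r1 + 1/2) (1/2 - r2) \<tau>"
    using theta_char_v_shift[of "1/2 - r1" "1/2 - r2" "-1" \<tau>] by (simp add: algebra_simps)
  finally have "theta_normal r1 r2 (- 1 / \<tau>) = csqrt (- \<i> * \<tau>) * (e (complex_of_real ((r1 * r2 - r2) / 2)) *
      e (complex_of_real ((r2 + 1/2) * (1/2 - r1))) * e (complex_of_real (- (1/2 - r1)))) * theta_char (- r1 + 1/2) (1/2 - r2) \<tau>"
    unfolding theta_normal_def theta_r_eq theta_char_neg_inverse[OF \<tau>] by (simp only: mult_ac)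
  also have "\<dots> = csqrt (- \<i> * \<tau>) * (e (- 1/4) * e (complex_of_real ((r2 * (- r1) - (- r1)) / 2))) * theta_char (- r1 + 1/2) (1/2 - r2) \<tau>"
    unfolding e_add[symmetric]
    by (rule arg_cong[where f = "\<lambda>x. _ * e x * _"]) (simp add: field_simps)
  finally show ?thesis by (simp add: theta_normal_def theta_r_eq mult_ac)
qed

lemma theta_normal_shift:
  "theta_normal (r1 + of_int m1) (r2 + of_int m2) \<tau> =
     e (complex_of_real ((r1 * of_int m2 - r2 * of_int m1 + of_int m1 * of_int m2 - of_int m1 - of_int m2) / 2)) * theta_normal r1 r2 \<tau>"
proof -
  have "theta_r (r1 + of_int m1) (r2 + of_int m2) \<tau> = theta_char (r2 + 1/2) (1/2 - r1 + of_int (- m1)) \<tau>"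
    using theta_char_u_shift[of "r2 + 1/2" m2 "1/2 - r1 - of_int m1" \<tau>]
    by (simp add: theta_r_eq algebra_simps)
  also have "\<dots> = e (complex_of_real ((r2 + 1/2) * of_int (- m1))) * theta_r r1 r2 \<tau>"
    unfolding theta_char_v_shift theta_r_eq ..
  finally have "theta_normal (r1 + of_int m1) (r2 + of_int m2) \<tau> =
      e (complex_of_real (((r1 + of_int m1) * (r2 + of_int m2) - (r2 + of_int m2)) / 2) + complex_of_real ((r2 + 1/2) * of_int (- m1))) * theta_r r1 r2 \<tau>"
    by (simp only: theta_normal_def e_add mult.assoc)
  also have "complex_of_real (((r1 + of_int m1) * (r2 + of_int m2) - (r2 + of_int m2)) / 2) + complex_of_real ((r2 + 1/2) * of_int (- m1)) =
     complex_of_real ((r1 * of_int m2 - r2 * of_int m1 + of_int m1 * of_int m2 - of_int m1 - of_int m2) / 2) + complex_of_real ((r1 * r2 - r2) / 2)"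
    by (simp add: field_simps)
  finally show ?thesis by (simp only: theta_normal_def e_add mult.assoc)
qed

lemma theta_normal_plus_int: "theta_normal r1 r2 (\<tau> + of_int n) = e (of_int n / 8) * theta_normal (r1 - of_int n * r2) r2 \<tau>"
proof (induction n arbitrary: r1 rule: int_induct[where k = 0])
  case (step1 i)
  have "theta_normal r1 r2 (\<tau> + of_int (i + 1)) = theta_normal r1 r2 (\<tau> + of_int i + 1)" by (simp add: add_ac)
  also have "\<dots> = e (1/8) * e (of_int i / 8) * theta_normal (r1 - r2 - of_int i * r2) r2 \<tau>"
    unfolding theta_normal_plus_one step1 by simp
  finally show ?case by (simp add: e_add[symmetric] algebra_simps add_divide_distrib)
next
  case (step2 i)
  \<comment> \<open>The one-step rule, used at \<open>r1 + r2\<close> and read backwards.\<close>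
  have "e (1/8) * theta_normal r1 r2 (\<tau> + of_int (i - 1)) = theta_normal (r1 + r2) r2 (\<tau> + of_int (i - 1) + 1)"
    unfolding theta_normal_plus_one by simp
  also have "\<dots> = theta_normal (r1 + r2) r2 (\<tau> + of_int i)" by simp
  also have "\<dots> = e (1/8 + of_int (i - 1) / 8) * theta_normal (r1 - of_int (i - 1) * r2) r2 \<tau>"
    unfolding step2 by (simp add: algebra_simps add_divide_distrib[symmetric])
  finally show ?case by (simp add: e_add)
qed simp

lemma eta_plus_int: "eta (\<tau> + of_int n) = e (of_int n / 24) * eta \<tau>"
proof (induction n rule: int_induct[where k = 0])
  case (step1 i)
  have "eta (\<tau> + of_int (i + 1)) = eta (\<tau> + of_int i + 1)" by (simp add: add_ac)
  thus ?case unfolding eta_plus_one step1 by (simp add: e_add add_divide_distrib)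
next
  case (step2 i)
  have "e (1/24) * eta (\<tau> + of_int (i - 1)) = eta (\<tau> + of_int (i - 1) + 1)"
    unfolding eta_plus_one by simp
  also have "\<dots> = e (of_int i / 24) * eta \<tau>" using step2 by simp
  also have "of_int i / 24 = 1/24 + complex_of_int (i - 1) / 24" by (simp add: field_simps)
  finally show ?case by (simp add: e_add)
qed simp

lemma uhp_denom_nonzero:
  assumes "a * d - b * c = (1::int)" "\<tau> \<in> uhp"
  shows "of_int c * \<tau> + of_int d \<noteq> 0"
proof
  assume *: "of_int c * \<tau> + of_int d = 0"
  have "Im (of_int c * \<tau> + of_int d) = of_int c * Im \<tau>" by simp
  with * assms(2) have "c = 0" by (simp add: uhp_def)
  with * have "d = 0" by simp
  with \<open>c = 0\<close> assms(1) show False by simp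
qed

lemma moebius_in_uhp:
  assumes "a * d - b * c = (1::int)" "\<tau> \<in> uhp"
  shows "moebius (a,b,c,d) \<tau> \<in> uhp"
proof -
  define w where "w = of_int c * \<tau> + of_int d"
  have w: "w \<noteq> 0" unfolding w_def by (rule uhp_denom_nonzero[OF assms])
  have "Im (moebius (a,b,c,d) \<tau>) = Im ((of_int a * \<tau> + of_int b) * cnj w) / (norm w)^2"
    by (simp add: w_def complex_div_cnj[of _ "of_int c * \<tau> + of_int d"])
  also have "Im ((of_int a * \<tau> + of_int b) * cnj w) = of_int (a * d - b * c) * Im \<tau>"
    by (simp add: w_def algebra_simps)
  finally show ?thesis using assms w by (simp add: uhp_def)
qed

text \<open>One pair \<open>(\<epsilon>, k)\<close> must serve for \<open>\<eta>\<close> and for all \<open>\<Phi>\<^bsub>r\<^esub>\<close> at once: composing such pairs then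
  needs no cocycle computation for the square roots.\<close>
definition modular_transf :: "mat2 \<Rightarrow> bool" where
  "modular_transf A \<longleftrightarrow> (case A of (a,b,c,d) \<Rightarrow> \<exists>\<epsilon> k. is_Mp2 A \<epsilon> \<and>
     (\<forall>\<tau>\<in>uhp. eta (moebius A \<tau>) = k * \<epsilon> \<tau> * eta \<tau> \<and>
       (\<forall>r1 r2. theta_normal r1 r2 (moebius A \<tau>) = k^3 * \<epsilon> \<tau> * theta_normal (of_int d * r1 - of_int b * r2) (of_int a * r2 - of_int c * r1) \<tau>)))"

lemma modular_transf_one: "modular_transf (1, 0, 0, 1)"
  unfolding modular_transf_def
  by (auto intro!: exI[of _ "\<lambda>_. 1"] exI[of _ 1] simp: SL2Z_def)

text \<open>Left multiplication by \<open>T^n\<close> keeps the bottom row, hence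
  \<open>\<epsilon>\<close>. The constant gains \<open>e (n / 24)\<close>, whose cube is the theta
  multiplier \<open>e (n / 8)\<close>.\<close>

lemma modular_transf_T:
  assumes "modular_transf (a, b, c, d)"
  shows "modular_transf (a + n * c, b + n * d, c, d)"
proof -
  from assms obtain \<epsilon> k where Mp: "is_Mp2 (a,b,c,d) \<epsilon>" and
    eta: "\<And>\<tau>. \<tau> \<in> uhp \<Longrightarrow> eta (moebius (a,b,c,d) \<tau>) = k * \<epsilon> \<tau> * eta \<tau>" and
    theta_normal: "\<And>\<tau> r1 r2. \<tau> \<in> uhp \<Longrightarrow> theta_normal r1 r2 (moebius (a,b,c,d) \<tau>) =
        k^3 * \<epsilon> \<tau> * theta_normal (of_int d * r1 - of_int b * r2) (of_int a * r2 - of_int c * r1) \<tau>"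
    unfolding modular_transf_def by fast
  have det: "a * d - b * c = 1" using Mp by (simp add: SL2Z_def)
  have moeb: "moebius (a + n * c, b + n * d, c, d) \<tau> = moebius (a,b,c,d) \<tau> + of_int n" if "\<tau> \<in> uhp" for \<tau>
    using uhp_denom_nonzero[OF det that] by (simp add: field_simps)
  have k3: "(e (of_int n / 24) * k)^3 = e (of_int n / 8) * k^3"
    by (simp add: power_mult_distrib e_of_nat_mult[symmetric])
  have "is_Mp2 (a + n * c, b + n * d, c, d) \<epsilon>"
    using Mp by (simp add: SL2Z_def algebra_simps)
  moreover have "eta (moebius (a + n * c, b + n * d, c, d) \<tau>) = e (of_int n / 24) * k * \<epsilon> \<tau> * eta \<tau>" if "\<tau> \<in> uhp" for \<tau>
    unfolding moeb[OF that] eta_plus_int eta[OF that] by (simp only: mult.assoc)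
  moreover have "theta_normal r1 r2 (moebius (a + n * c, b + n * d, c, d) \<tau>) = (e (of_int n / 24) * k)^3 * \<epsilon> \<tau> *
      theta_normal (of_int d * r1 - of_int (b + n * d) * r2) (of_int (a + n * c) * r2 - of_int c * r1) \<tau>" if "\<tau> \<in> uhp" for \<tau> r1 r2
    unfolding moeb[OF that] theta_normal_plus_int theta_normal[OF that] k3 by (simp add: algebra_simps)
  ultimately show ?thesis
    unfolding modular_transf_def by blast
qed

text \<open>Left multiplication by \<open>S\<close>. The new constant is
  \<open>e (- 1/8) * k\<close>; its cube times the \<open>e (1/8)\<close> inside
  \<open>\<epsilon>'\<close> gives the factor \<open>e (- 1/4)\<close> of theta inversion.\<close>

lemma modular_transf_S:
  assumes "modular_transf (a, b, c, d)"
  shows "modular_transf (- c, - d, a, b)"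
proof -
  from assms obtain \<epsilon> k where Mp: "is_Mp2 (a,b,c,d) \<epsilon>" and
    eta: "\<And>\<tau>. \<tau> \<in> uhp \<Longrightarrow> eta (moebius (a,b,c,d) \<tau>) = k * \<epsilon> \<tau> * eta \<tau>" and
    theta_normal: "\<And>\<tau> r1 r2. \<tau> \<in> uhp \<Longrightarrow> theta_normal r1 r2 (moebius (a,b,c,d) \<tau>) =
        k^3 * \<epsilon> \<tau> * theta_normal (of_int d * r1 - of_int b * r2) (of_int a * r2 - of_int c * r1) \<tau>"
    unfolding modular_transf_def by fast
  have det: "a * d - b * c = 1" using Mp by (simp add: SL2Z_def)
  have det': "(- c) * b - (- d) * a = 1" using det by (simp add: algebra_simps)
  note uhp = moebius_in_uhp[OF det]
  note nz = uhp_denom_nonzero[OF det] uhp_denom_nonzero[OF det']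
  have moeb: "moebius (- c, - d, a, b) \<tau> = - 1 / moebius (a,b,c,d) \<tau>" if "\<tau> \<in> uhp" for \<tau>
    using nz[OF that] by (simp add: divide_simps)
  \<comment> \<open>As \<open>e (1/8)^2 = \<i>\<close> cancels the \<open>- \<i>\<close> under the
    root, the square is the image point times \<open>c \<tau> + d\<close>, that is
    \<open>a \<tau> + b\<close>.\<close>
  define \<epsilon>' where "\<epsilon>' = (\<lambda>\<tau>. e (1/8) * csqrt (- \<i> * moebius (a,b,c,d) \<tau>) * \<epsilon> \<tau>)"
  have "e (1/8)^2 = \<i>"
    unfolding e_of_nat_mult[symmetric] using cis_pi_half by (simp add: e_def cis_conv_exp mult_ac)
  hence "\<epsilon>' \<tau> ^ 2 = of_int a * \<tau> + of_int b" if "\<tau> \<in> uhp" for \<tau>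
    using Mp that nz(1)[OF that] by (simp add: \<epsilon>'_def power_mult_distrib)
  moreover have "continuous_on uhp (\<lambda>\<tau>. csqrt (- \<i> * moebius (a,b,c,d) \<tau>))"
  proof (rule continuous_on_compose2[of "- \<real>\<^sub>\<le>\<^sub>0" csqrt])
    show "continuous_on (- \<real>\<^sub>\<le>\<^sub>0) csqrt"
      by (simp add: continuous_on_csqrt)
    show "continuous_on uhp (\<lambda>\<tau>. - \<i> * moebius (a,b,c,d) \<tau>)"
      using nz(1) by (auto intro!: continuous_intros)
    show "(\<lambda>\<tau>. - \<i> * moebius (a,b,c,d) \<tau>) ` uhp \<subseteq> - \<real>\<^sub>\<le>\<^sub>0"
      using neg_i_mult_uhp[OF uhp] by blast
  qed
  ultimately have "is_Mp2 (- c, - d, a, b) \<epsilon>'"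
    using Mp det' unfolding \<epsilon>'_def by (auto simp: SL2Z_def intro!: continuous_intros)
  moreover have "eta (moebius (- c, - d, a, b) \<tau>) = (e (- 1/8) * k) * \<epsilon>' \<tau> * eta \<tau>" if "\<tau> \<in> uhp" for \<tau>
    unfolding moeb[OF that] eta_neg_inverse[OF uhp[OF that]] eta[OF that] \<epsilon>'_def
    by (simp add: e_minus)
  moreover have "theta_normal r1 r2 (moebius (- c, - d, a, b) \<tau>) = (e (- 1/8) * k)^3 * \<epsilon>' \<tau> *
      theta_normal (of_int b * r1 - of_int (- d) * r2) (of_int (- c) * r2 - of_int a * r1) \<tau>" if "\<tau> \<in> uhp" for \<tau> r1 r2
  proof -
    have eq: "e (- 1/8)^3 * e (1/8) = e (- 1/4)"
      unfolding e_of_nat_mult[symmetric] e_add[symmetric] by simp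
    have "(e (- 1/8) * k)^3 * \<epsilon>' \<tau> = e (- 1/4) * csqrt (- \<i> * moebius (a,b,c,d) \<tau>) * (k^3 * \<epsilon> \<tau>)"
      unfolding \<epsilon>'_def power_mult_distrib eq[symmetric] by (simp only: mult_ac)
    moreover have "of_int b * r1 - of_int (- d) * r2 = of_int d * r2 - of_int b * (- r1)"
      "of_int (- c) * r2 - of_int a * r1 = of_int a * (- r1) - of_int c * r2"
      by simp_all
    ultimately show ?thesis
      unfolding moeb[OF that] theta_normal_neg_inverse[OF uhp[OF that]] theta_normal[OF that] by (simp only: mult.assoc)
  qed
  ultimately show ?thesis
    unfolding modular_transf_def by blast
qed

text \<open>The Euclidean algorithm on the first column. For \<open>c = 0\<close> the matrix is a
  power of \<open>T\<close> up to sign, and \<open>S^2\<close> supplies the sign.\<close>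

lemma modular_transf_SL2Z: "a * d - b * c = 1 \<Longrightarrow> modular_transf (a, b, c, d)"
proof (induction "nat \<bar>c\<bar>" arbitrary: a b c d rule: less_induct)
  case less
  show ?case
  proof (cases "c = 0")
    case True
    with less.prems have "a * d = 1" by simp
    hence "a = 1 \<and> d = 1 \<or> a = - 1 \<and> d = - 1"
      by (auto simp: zmult_eq_1_iff)
    moreover have "modular_transf (1, b, 0, 1)"
      using modular_transf_T[OF modular_transf_one, of b] by simp
    moreover have "modular_transf (- 1, b, 0, - 1)"
      using modular_transf_T[OF modular_transf_S[OF modular_transf_S[OF modular_transf_one]], of "- b"] by simp
    ultimately show ?thesis using True by auto
  next
    case False
    define q where "q = a div c"
    have "a - q * c = a mod c" by (simp add: q_def minus_div_mult_eq_mod)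
    hence "nat \<bar>- (a - q * c)\<bar> < nat \<bar>c\<bar>"
      using abs_mod_less[OF False, of a] by simp
    moreover have "c * (- (b - q * d)) - d * (- (a - q * c)) = 1"
      using less.prems by (simp add: algebra_simps)
    \<comment> \<open>With this matrix as \<open>B\<close>, the given one is
      \<open>T^q S B\<close>.\<close>
    ultimately have "modular_transf (c, d, - (a - q * c), - (b - q * d))"
      by (rule less.hyps)
    from modular_transf_T[OF modular_transf_S[OF this], of q] show ?thesis by simp
  qed
qed

section \<open>The multiplier for an arbitrary metaplectic lift\<close>

text \<open>The quotient of two choices is continuous with values \<open>1\<close> and
  \<open>-1\<close>, hence constant on the connected half plane.\<close>

lemma Mp2_unique_up_to_sign:
  assumes "is_Mp2 (a,b,c,d) \<epsilon>" "is_Mp2 (a,b,c,d) \<epsilon>'"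
  obtains \<sigma> where "\<sigma>^2 = 1" "\<And>\<tau>. \<tau> \<in> uhp \<Longrightarrow> \<epsilon> \<tau> = \<sigma> * \<epsilon>' \<tau>"
proof -
  have det: "a * d - b * c = 1" using assms(1) by (simp add: SL2Z_def)
  have sq: "\<epsilon> \<tau>^2 = of_int c * \<tau> + of_int d" "\<epsilon>' \<tau>^2 = of_int c * \<tau> + of_int d" if "\<tau> \<in> uhp" for \<tau>
    using assms that by auto
  have nz: "\<epsilon>' \<tau> \<noteq> 0" if "\<tau> \<in> uhp" for \<tau>
    using sq(2)[OF that] uhp_denom_nonzero[OF det that] by (metis zero_power2)
  have one: "(\<epsilon> \<tau> / \<epsilon>' \<tau>)^2 = 1" if "\<tau> \<in> uhp" for \<tau>
    using sq[OF that] uhp_denom_nonzero[OF det that] by (simp add: power_divide)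
  have "(\<lambda>\<tau>. \<epsilon> \<tau> / \<epsilon>' \<tau>) constant_on uhp"
  proof (rule continuous_finite_range_constant[OF connected_uhp])
    show "continuous_on uhp (\<lambda>\<tau>. \<epsilon> \<tau> / \<epsilon>' \<tau>)"
      using assms nz by (auto intro!: continuous_intros)
    have "(\<lambda>\<tau>. \<epsilon> \<tau> / \<epsilon>' \<tau>) ` uhp \<subseteq> {1, -1}"
      using one[unfolded power2_eq_1_iff] by blast
    thus "finite ((\<lambda>\<tau>. \<epsilon> \<tau> / \<epsilon>' \<tau>) ` uhp)" by (rule finite_subset) simp
  qed
  then obtain \<sigma> where \<sigma>: "\<And>\<tau>. \<tau> \<in> uhp \<Longrightarrow> \<epsilon> \<tau> / \<epsilon>' \<tau> = \<sigma>"
    unfolding constant_on_def by blast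
  have "\<i> \<in> uhp" by (simp add: uhp_def)
  hence "\<sigma>^2 = 1" using one \<sigma> by metis
  moreover have "\<epsilon> \<tau> = \<sigma> * \<epsilon>' \<tau>" if "\<tau> \<in> uhp" for \<tau>
    using \<sigma>[OF that] nz[OF that] by (simp add: field_simps)
  ultimately show ?thesis using that by blast
qed

text \<open>The description in \<open>psi\<close> is unique: at \<open>\<i>\<close> neither
  \<open>\<epsilon>\<close> nor \<open>eta\<close> vanishes, so the constant can be solved
  for.\<close>

lemma psi_eqI:
  assumes Mp: "is_Mp2 (a,b,c,d) \<epsilon>"
    and k: "\<And>\<tau>. \<tau> \<in> uhp \<Longrightarrow> eta (moebius (a,b,c,d) \<tau>) = k * \<epsilon> \<tau> * eta \<tau>"
  shows "psi (a,b,c,d) \<epsilon> = k"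
  unfolding psi_def
proof (rule the_equality)
  have i: "\<i> \<in> uhp" by (simp add: uhp_def)
  have "(\<epsilon> \<i>)^2 = of_int c * \<i> + of_int d" using Mp i by auto
  also have "\<dots> \<noteq> 0"
    using Mp by (intro uhp_denom_nonzero[OF _ i, of a d b c]) (simp add: SL2Z_def)
  finally have nz: "\<epsilon> \<i> * eta \<i> \<noteq> 0" using eta_nonzero[OF i] by auto
  fix k' assume "\<forall>\<tau>\<in>uhp. eta (moebius (a,b,c,d) \<tau>) = k' * \<epsilon> \<tau> * eta \<tau>"
  hence "k' * (\<epsilon> \<i> * eta \<i>) = k * (\<epsilon> \<i> * eta \<i>)"
    using k[OF i] i by (metis mult.assoc)
  thus "k' = k" using nz by simp
qed (use k in blast)

text \<open>Changing \<open>\<epsilon>'\<close> by a sign \<open>\<sigma>\<close> changes the eta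
  constant by \<open>\<sigma>\<close> too, and \<open>\<sigma>^3 * \<sigma> = 1\<close>: the product
  of the cubed constant and the root is independent of the choice.\<close>

lemma theta_normal_moebius:
  assumes Mp: "is_Mp2 (a,b,c,d) \<epsilon>" and \<tau>: "\<tau> \<in> uhp"
  shows "theta_normal r1 r2 (moebius (a,b,c,d) \<tau>) =
     psi (a,b,c,d) \<epsilon>^3 * \<epsilon> \<tau> * theta_normal (of_int d * r1 - of_int b * r2) (of_int a * r2 - of_int c * r1) \<tau>"
proof -
  have "modular_transf (a,b,c,d)"
    using Mp by (intro modular_transf_SL2Z) (simp add: SL2Z_def)
  then obtain \<epsilon>' k where Mp': "is_Mp2 (a,b,c,d) \<epsilon>'" and
    eta: "\<And>\<tau>. \<tau> \<in> uhp \<Longrightarrow> eta (moebius (a,b,c,d) \<tau>) = k * \<epsilon>' \<tau> * eta \<tau>" and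
    theta_normal: "\<And>\<tau> r1 r2. \<tau> \<in> uhp \<Longrightarrow> theta_normal r1 r2 (moebius (a,b,c,d) \<tau>) =
        k^3 * \<epsilon>' \<tau> * theta_normal (of_int d * r1 - of_int b * r2) (of_int a * r2 - of_int c * r1) \<tau>"
    unfolding modular_transf_def by fast
  obtain \<sigma> where \<sigma>: "\<sigma>^2 = 1" "\<And>\<tau>. \<tau> \<in> uhp \<Longrightarrow> \<epsilon> \<tau> = \<sigma> * \<epsilon>' \<tau>"
    using Mp2_unique_up_to_sign[OF Mp Mp'] by blast
  have "psi (a,b,c,d) \<epsilon> = \<sigma> * k"
  proof (rule psi_eqI[OF Mp])
    fix \<tau> assume \<tau>: "\<tau> \<in> uhp"
    have "\<sigma> * k * \<epsilon> \<tau> * eta \<tau> = \<sigma>^2 * (k * \<epsilon>' \<tau> * eta \<tau>)"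
      unfolding \<sigma>(2)[OF \<tau>] by (simp add: power2_eq_square mult_ac)
    thus "eta (moebius (a,b,c,d) \<tau>) = \<sigma> * k * \<epsilon> \<tau> * eta \<tau>"
      by (simp only: \<sigma>(1) eta[OF \<tau>] mult_1_left)
  qed
  hence "psi (a,b,c,d) \<epsilon>^3 * \<epsilon> \<tau> = (\<sigma>^2)^2 * (k^3 * \<epsilon>' \<tau>)"
    unfolding \<sigma>(2)[OF \<tau>] by (simp add: power_mult_distrib power2_eq_square power3_eq_cube mult_ac)
  also have "\<dots> = k^3 * \<epsilon>' \<tau>" unfolding \<sigma>(1) by simp
  finally show ?thesis unfolding theta_normal[OF \<tau>] by simp
qed

section \<open>Integral shifts and the character property\<close>

text \<open>The shift is \<open>A^-1 r - r = - A^-1 (A r - r)\<close>, an integral matrix applied to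
  an integral vector.\<close>

lemma Gamma_r_inverse_shift:
  assumes "(a,b,c,d) \<in> Gamma_r r1 r2"
  obtains m1 m2 :: int where "of_int d * r1 - of_int b * r2 = r1 + of_int m1"
    "of_int a * r2 - of_int c * r1 = r2 + of_int m2"
proof -
  have "a * d - b * c = 1" using assms by (simp add: Gamma_r_def SL2Z_def)
  hence det: "of_int a * of_int d - of_int b * of_int c = (1::real)"
    by (metis of_int_1 of_int_diff of_int_mult)
  obtain n1 n2 :: int where n: "of_int a * r1 + of_int b * r2 - r1 = of_int n1" "of_int c * r1 + of_int d * r2 - r2 = of_int n2"
    using assms unfolding Gamma_r_def by (auto elim!: Ints_cases)
  show ?thesis
  proof
    show "of_int d * r1 - of_int b * r2 = r1 + of_int (b * n2 - d * n1)"
      unfolding of_int_diff of_int_mult n[symmetric] using det by algebra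
    show "of_int a * r2 - of_int c * r1 = r2 + of_int (c * n1 - a * n2)"
      unfolding of_int_diff of_int_mult n[symmetric] using det by algebra
  qed
qed

text \<open>Identifies \<open>chi_r\<close> with the phase in \<open>theta_normal_shift\<close>. The
  real exponents agree exactly, not just modulo integers, once the determinant relation is
  used.\<close>

lemma chi_r_eq:
  assumes "a * d - b * c = 1"
    and "of_int d * r1 - of_int b * r2 = r1 + of_int m1" "of_int a * r2 - of_int c * r1 = r2 + of_int m2"
  shows "chi_r r1 r2 (a,b,c,d) =
    e (complex_of_real ((r1 * of_int m2 - r2 * of_int m1 + of_int m1 * of_int m2 - of_int m1 - of_int m2) / 2))"
proof -
  have det: "of_int a * of_int d - of_int b * of_int c = (1::real)"
    using assms(1) by (metis of_int_1 of_int_diff of_int_mult)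
  have m: "of_int m1 = of_int d * r1 - of_int b * r2 - r1" "of_int m2 = of_int a * r2 - of_int c * r1 - r2"
    using assms(2,3) by simp_all
  have "(of_int c - of_int d + 1) * r1 + (- of_int a + of_int b + 1) * r2
       - of_int c * of_int d * r1^2 + 2 * (of_int a - 1) * of_int d * r1 * r2 - (of_int a - 2) * of_int b * r2^2
     = r1 * of_int m2 - r2 * of_int m1 + of_int m1 * of_int m2 - of_int m1 - of_int m2"
    unfolding m using det by algebra
  thus ?thesis by simp
qed

lemma chi_r_mult:
  assumes A: "(a,b,c,d) \<in> Gamma_r r1 r2" and B: "(a',b',c',d') \<in> Gamma_r r1 r2"
  shows "chi_r r1 r2 (mmult (a,b,c,d) (a',b',c',d')) = chi_r r1 r2 (a,b,c,d) * chi_r r1 r2 (a',b',c',d')"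
proof -
  have det: "a * d - b * c = 1" and det': "a' * d' - b' * c' = 1"
    using A B by (simp_all add: Gamma_r_def SL2Z_def)
  hence rdet': "of_int a' * of_int d' - of_int b' * of_int c' = (1::real)"
    by (metis of_int_1 of_int_diff of_int_mult)
  obtain m1 m2 where m: "of_int d * r1 - of_int b * r2 = r1 + of_int m1" "of_int a * r2 - of_int c * r1 = r2 + of_int m2"
    using Gamma_r_inverse_shift[OF A] .
  obtain n1 n2 where n: "of_int d' * r1 - of_int b' * r2 = r1 + of_int n1" "of_int a' * r2 - of_int c' * r1 = r2 + of_int n2"
    using Gamma_r_inverse_shift[OF B] .
  \<comment> \<open>The shift of the product:
    \<open>(A B)^-1 r - r = B^-1 (r + m) - r = B^-1 m + n\<close>.\<close>
  define M1 M2 where "M1 = d' * m1 - b' * m2 + n1" and "M2 = a' * m2 - c' * m1 + n2"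
  have detM: "(a * a' + b * c') * (c * b' + d * d') - (a * b' + b * d') * (c * a' + d * c') = 1"
    using det det' by algebra
  have M: "of_int (c * b' + d * d') * r1 - of_int (a * b' + b * d') * r2 = r1 + of_int M1"
     "of_int (a * a' + b * c') * r2 - of_int (c * a' + d * c') * r1 = r2 + of_int M2"
    unfolding M1_def M2_def of_int_add of_int_diff of_int_mult using m n by algebra+
  \<comment> \<open>Twice the difference of the exponents, with \<open>r\<close> eliminated: its
    terms in \<open>r\<close> combine to the determinant of \<open>m\<close> and \<open>B n\<close>,
    because \<open>B n = r - B r\<close>.\<close>
  define X where "X = m1 * (c' * n1 + d' * n2) - m2 * (a' * n1 + b' * n2) + M1 * M2 - M1 - M2
     - (m1 * m2 - m1 - m2) - (n1 * n2 - n1 - n2)"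
  \<comment> \<open>Modulo 2 the form \<open>m1 m2 + m1 + m2\<close> is unchanged under
    \<open>B^-1\<close>, and its polar form is the determinant. The cross term of
    \<open>B^-1 m\<close> and \<open>n\<close> therefore cancels the determinant in
    \<open>X\<close>.\<close>
  have "odd (a' * d' - b' * c')" using det' by simp
  hence "even X"
    unfolding X_def M1_def M2_def by auto
  then obtain Y where Y: "X = 2 * Y" by blast
  have half: "x / 2 - (y / 2 + z / 2) = w" if "x - y - z = 2 * w" for x y z w :: real
    using that by simp
  have n': "of_int a' * of_int n1 + of_int b' * of_int n2 = r1 - of_int a' * r1 - of_int b' * r2"
    "of_int c' * of_int n1 + of_int d' * of_int n2 = r2 - of_int c' * r1 - of_int d' * r2"
    using n rdet' by algebra+
  have "(r1 * of_int M2 - r2 * of_int M1 + of_int M1 * of_int M2 - of_int M1 - of_int M2)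
     - (r1 * of_int m2 - r2 * of_int m1 + of_int m1 * of_int m2 - of_int m1 - of_int m2)
     - (r1 * of_int n2 - r2 * of_int n1 + of_int n1 * of_int n2 - of_int n1 - of_int n2) = of_int X"
    unfolding X_def of_int_add of_int_diff of_int_mult n' M1_def M2_def by algebra
  hence "(r1 * of_int M2 - r2 * of_int M1 + of_int M1 * of_int M2 - of_int M1 - of_int M2) / 2
     - ((r1 * of_int m2 - r2 * of_int m1 + of_int m1 * of_int m2 - of_int m1 - of_int m2) / 2
      + (r1 * of_int n2 - r2 * of_int n1 + of_int n1 * of_int n2 - of_int n1 - of_int n2) / 2) = of_int Y"
    unfolding Y of_int_mult of_int_numeral by (rule half)
  from this[THEN arg_cong, of complex_of_real]
  have "complex_of_real ((r1 * of_int M2 - r2 * of_int M1 + of_int M1 * of_int M2 - of_int M1 - of_int M2) / 2)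
     - (complex_of_real ((r1 * of_int m2 - r2 * of_int m1 + of_int m1 * of_int m2 - of_int m1 - of_int m2) / 2)
      + complex_of_real ((r1 * of_int n2 - r2 * of_int n1 + of_int n1 * of_int n2 - of_int n1 - of_int n2) / 2)) = of_int Y"
    by (simp only: of_real_diff of_real_add of_real_of_int_eq)
  hence "e (complex_of_real ((r1 * of_int M2 - r2 * of_int M1 + of_int M1 * of_int M2 - of_int M1 - of_int M2) / 2)) =
     e (complex_of_real ((r1 * of_int m2 - r2 * of_int m1 + of_int m1 * of_int m2 - of_int m1 - of_int m2) / 2)
      + complex_of_real ((r1 * of_int n2 - r2 * of_int n1 + of_int n1 * of_int n2 - of_int n1 - of_int n2) / 2))"
    by (rule e_cong_int)
  thus ?thesis
    unfolding mmult.simps chi_r_eq[OF detM M] chi_r_eq[OF det m] chi_r_eq[OF det' n] by (simp only: e_add)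
qed

theorem theorem2p14:
  fixes r1 r2 :: real
  assumes "r1 \<in> \<rat>" and "r2 \<in> \<rat>"
  shows "(\<forall>a b c d \<epsilon> \<tau>. (a,b,c,d) \<in> Gamma_r r1 r2 \<and> is_Mp2 (a,b,c,d) \<epsilon> \<and> \<tau> \<in> uhp \<longrightarrow>
            theta_r r1 r2 (moebius (a,b,c,d) \<tau>) =
              (psi (a,b,c,d) \<epsilon>)^3 * chi_r r1 r2 (a,b,c,d) * \<epsilon> \<tau> * theta_r r1 r2 \<tau>)
       \<and> (\<forall>A\<in>Gamma_r r1 r2. \<forall>B\<in>Gamma_r r1 r2.
            chi_r r1 r2 (mmult A B) = chi_r r1 r2 A * chi_r r1 r2 B)"
proof (intro conjI allI impI ballI)
  fix a b c d \<epsilon> \<tau>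
  assume asm: "(a,b,c,d) \<in> Gamma_r r1 r2 \<and> is_Mp2 (a,b,c,d) \<epsilon> \<and> \<tau> \<in> uhp"
  have det: "a * d - b * c = 1" using asm by (simp add: Gamma_r_def SL2Z_def)
  obtain m1 m2 where m: "of_int d * r1 - of_int b * r2 = r1 + of_int m1" "of_int a * r2 - of_int c * r1 = r2 + of_int m2"
    using Gamma_r_inverse_shift[of a b c d r1 r2] asm by blast
  have "theta_normal r1 r2 (moebius (a,b,c,d) \<tau>) = psi (a,b,c,d) \<epsilon>^3 * \<epsilon> \<tau> * (chi_r r1 r2 (a,b,c,d) * theta_normal r1 r2 \<tau>)"
    using theta_normal_moebius[of a b c d \<epsilon> \<tau> r1 r2] asm unfolding m theta_normal_shift chi_r_eq[OF det m] by blast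
  \<comment> \<open>The normalising factor depends only on \<open>r\<close> and is nonzero, so it
    cancels.\<close>
  thus "theta_r r1 r2 (moebius (a,b,c,d) \<tau>) = psi (a,b,c,d) \<epsilon>^3 * chi_r r1 r2 (a,b,c,d) * \<epsilon> \<tau> * theta_r r1 r2 \<tau>"
    unfolding theta_normal_def by (simp del: moebius.simps chi_r.simps add: mult_ac)
next
  fix A B assume AB: "A \<in> Gamma_r r1 r2" "B \<in> Gamma_r r1 r2"
  obtain a b c d where A: "A = (a,b,c,d)" by (cases A)
  obtain a' b' c' d' where B: "B = (a',b',c',d')" by (cases B)
  show "chi_r r1 r2 (mmult A B) = chi_r r1 r2 A * chi_r r1 r2 B"
    using chi_r_mult AB unfolding A B by blast
qed

end
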